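(* Let $\mathcal{H}_3$ denote the universal homogeneous triangle-free graph. Then $\mathcal{H}_3$ has finite big Ramsey degrees: for every finite triangle-free graph $\mathrm{G}$ there is a natural number $T(\mathrm{G})$ such that for every $k\ge 1$ and every coloring of all copies of $\mathrm{G}$ in $\mathcal{H}_3$ into $k$ colors, there is an induced subgraph $\mathcal{H}'$ of $\mathcal{H}_3$ which is isomorphic to $\mathcal{H}_3$ and such that the copies of $\mathrm{G}$ contained in $\mathcal{H}'$ take no more than $T(\mathrm{G})$ colors.
   Context: A graph is triangle-free if it contains no three pairwise adjacent vertices. The universal homogeneous triangle-free graph $\mathcal{H}_3$ (Henson's graph) is the unique (up to isomorphism) countable triangle-free graph such that every countable triangle-free graph embeds into it as an induced subgraph and every isomorphism between finite induced subgraphs extends to an automorphism of $\mathcal{H}_3$; equivalently, it is the Fraïssé limit of the class of finite triangle-free graphs. A copy of $\mathrm{G}$ in a graph $\mathcal{H}$ is an induced subgraph of $\mathcal{H}$ isomorphic to $\mathrm{G}$. *)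

theory Defs
  imports Main "HOL-Library.Countable_Set"
begin

text \<open>A simple graph is a vertex set with a symmetric irreflexive adjacency relation on it.
  Since the adjacency relation is contained in the square of the vertex set, an induced
  subgraph is determined by its vertex set, and equality of graphs is the intended one.\<close>

record 'a sgraph =
  verts :: "'a set"
  edges :: "('a \<times> 'a) set"

definition is_graph :: "'a sgraph \<Rightarrow> bool" where
  "is_graph G \<longleftrightarrow> edges G \<subseteq> verts G \<times> verts G \<and> sym (edges G) \<and> irrefl (edges G)"

definition triangle_free :: "'a sgraph \<Rightarrow> bool" where
  "triangle_free G \<longleftrightarrow>
     \<not> (\<exists>u v w. (u, v) \<in> edges G \<and> (v, w) \<in> edges G \<and> (u, w) \<in> edges G)"

definition induced_subgraph :: "'a sgraph \<Rightarrow> 'a sgraph \<Rightarrow> bool" where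
  "induced_subgraph A H \<longleftrightarrow>
     verts A \<subseteq> verts H \<and> edges A = edges H \<inter> (verts A \<times> verts A)"

definition graph_iso :: "('a \<Rightarrow> 'b) \<Rightarrow> 'a sgraph \<Rightarrow> 'b sgraph \<Rightarrow> bool" where
  "graph_iso f G H \<longleftrightarrow>
     bij_betw f (verts G) (verts H) \<and>
     (\<forall>u\<in>verts G. \<forall>v\<in>verts G. (u, v) \<in> edges G \<longleftrightarrow> (f u, f v) \<in> edges H)"

definition isomorphic :: "'a sgraph \<Rightarrow> 'b sgraph \<Rightarrow> bool" where
  "isomorphic G H \<longleftrightarrow> (\<exists>f. graph_iso f G H)"

definition copies :: "'a sgraph \<Rightarrow> 'b sgraph \<Rightarrow> 'b sgraph set" where
  "copies G H = {A. induced_subgraph A H \<and> isomorphic G A}"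

definition embeds :: "'a sgraph \<Rightarrow> 'b sgraph \<Rightarrow> bool" where
  "embeds G H \<longleftrightarrow> (\<exists>A. induced_subgraph A H \<and> isomorphic G A)"

definition homogeneous :: "'a sgraph \<Rightarrow> bool" where
  "homogeneous H \<longleftrightarrow>
     (\<forall>A B f. induced_subgraph A H \<and> induced_subgraph B H \<and>
        finite (verts A) \<and> finite (verts B) \<and> graph_iso f A B \<longrightarrow>
        (\<exists>g. graph_iso g H H \<and> (\<forall>x\<in>verts A. g x = f x)))"

text \<open>A definition cannot quantify over types, so universality is stated for graphs whose
  vertices are natural numbers; every countable graph is isomorphic to one of these, and
  universality for graphs over arbitrary types is the lemma after the next definition.\<close>

definition universal_triangle_free :: "'a sgraph \<Rightarrow> bool" where
  "universal_triangle_free H \<longleftrightarrow>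
     (\<forall>G :: nat sgraph. is_graph G \<and> triangle_free G \<longrightarrow> embeds G H)"

definition henson_graph :: "'a sgraph \<Rightarrow> bool" where
  "henson_graph H \<longleftrightarrow>
     is_graph H \<and> countable (verts H) \<and> triangle_free H \<and>
     universal_triangle_free H \<and> homogeneous H"

lemma universal_triangle_free_embeds:
  fixes G :: "'b sgraph" and H :: "'a sgraph"
  assumes "universal_triangle_free H"
    and "is_graph G" "countable (verts G)" "triangle_free G"
  shows "embeds G H"
proof -
  define f where "f = to_nat_on (verts G)"
  have inj: "inj_on f (verts G)"
    unfolding f_def by (rule inj_on_to_nat_on[OF assms(3)])
  define N :: "nat sgraph"
    where "N = \<lparr>verts = f ` verts G, edges = map_prod f f ` edges G\<rparr>"
  have sub: "edges G \<subseteq> verts G \<times> verts G" and sy: "sym (edges G)" and ir: "irrefl (edges G)"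
    using assms(2) by (auto simp: is_graph_def)
  have N_iff: "(f u, f v) \<in> edges N \<longleftrightarrow> (u, v) \<in> edges G"
    if "u \<in> verts G" "v \<in> verts G" for u v
  proof
    assume "(f u, f v) \<in> edges N"
    then obtain a b where ab: "(a, b) \<in> edges G" "f u = f a" "f v = f b"
      by (auto simp: N_def)
    then have "u = a" "v = b" using sub inj that by (auto dest: inj_onD)
    with ab show "(u, v) \<in> edges G" by simp
  next
    assume "(u, v) \<in> edges G"
    then show "(f u, f v) \<in> edges N" by (force simp: N_def)
  qed
  have N_E: "\<exists>a b. x = f a \<and> y = f b \<and> a \<in> verts G \<and> b \<in> verts G \<and> (a, b) \<in> edges G"
    if "(x, y) \<in> edges N" for x y
    using that sub by (auto simp: N_def)
  have "is_graph N"
    unfolding is_graph_def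
  proof (intro conjI)
    show "edges N \<subseteq> verts N \<times> verts N" using sub by (auto simp: N_def)
    show "sym (edges N)"
      by (rule symI) (metis N_E N_iff sy symD)
    show "irrefl (edges N)"
      unfolding irrefl_def by (metis N_E N_iff inj inj_onD ir irrefl_def)
  qed
  moreover have "triangle_free N"
    unfolding triangle_free_def
  proof (rule notI, elim exE conjE)
    fix u v w
    assume e: "(u, v) \<in> edges N" "(v, w) \<in> edges N" "(u, w) \<in> edges N"
    obtain a b where ab: "u = f a" "v = f b" "a \<in> verts G" "b \<in> verts G"
      using N_E[OF e(1)] by blast
    obtain c where c: "w = f c" "c \<in> verts G"
      using N_E[OF e(2)] by blast
    have "(a, b) \<in> edges G" "(b, c) \<in> edges G" "(a, c) \<in> edges G"
      using e ab c N_iff by auto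
    then show False using assms(4) unfolding triangle_free_def by blast
  qed
  ultimately obtain A h where A: "induced_subgraph A H" and h: "graph_iso h N A"
    using assms(1) unfolding universal_triangle_free_def embeds_def isomorphic_def by blast
  have bij_f: "bij_betw f (verts G) (verts N)"
    using inj by (simp add: N_def bij_betw_def)
  have "graph_iso (h \<circ> f) G A"
    unfolding graph_iso_def
  proof (intro conjI ballI)
    show "bij_betw (h \<circ> f) (verts G) (verts A)"
      using bij_f h by (auto simp: graph_iso_def intro: bij_betw_trans)
    fix u v assume uv: "u \<in> verts G" "v \<in> verts G"
    then have "f u \<in> verts N" "f v \<in> verts N" by (auto simp: N_def)
    then show "(u, v) \<in> edges G \<longleftrightarrow> ((h \<circ> f) u, (h \<circ> f) v) \<in> edges A"
      using h N_iff[OF uv] by (simp add: graph_iso_def)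
  qed
  with A show ?thesis unfolding embeds_def isomorphic_def by blast
qed

end

theory Submission imports Defs "HOL-Library.FuncSet" begin

text \<open>The argument is Hubicka's.  Finite 0-1 words carry a triangle-free graph into which every
  countable triangle-free graph embeds, so this graph and the given one embed into each other.
  Substituting words into an infinite parameter word (a sequence in which the parameters
  \<open>0, 1, 2, \<dots>\<close> first occur in this order) is an embedding of the word graph into itself.  Every set of
  \<open>g\<close> words is obtained by substitution into a finite parameter word whose number of parameters depends
  on \<open>g\<close> only.  Hence the Ramsey theorem of Carlson and Simpson for finite parameter words yields
  a copy on which the colour depends only on the position inside the envelope.

  For words without parameters the Ramsey theorem follows from the Hales-Jewett theorem by a largeness
  argument in the style of Baumgartner's proof of Hindman's theorem; parameters are added by fusion.\<close>

section \<open>Rigid maps and parameter words\<close>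

text \<open>Adjacency of two words inspects the longer one at the position given by the length of
  the shorter one, so lengths have to move like positions. This is why parameters must first occur
  in order and why \<open>subst\<close> cuts a word at the first parameter left without a value: the
  end of \<open>U\<close> and the entry tested there both move to
  \<open>first_pos W (length U)\<close>.

  At a given position, a set of \<open>g\<close> words shows only which words reach it and which of
  them have a 1 there. That makes at most \<open>2 ^ g * 2 ^ g\<close> kinds of positions, whence
  the number of parameters of an envelope. Once the colour is constant on envelopes, one value
  remains for each set of short words, however many colours there were.

  In the parameterless case the obstacle is that largeness promises a single word in every subspace,
  while a subspace all of whose words lie in the set is wanted. Compactness turns the single words
  into finitely many stems that serve all tails, and Hales-Jewett makes the choice of the stem
  independent of a new letter. Repeating this letter by letter is possible because largeness
  survives a finite partition on some subspace.\<close>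

definition rigid :: "(nat \<Rightarrow> nat) \<Rightarrow> bool" where
  "rigid W \<longleftrightarrow> (\<forall>m. \<exists>j. W j = m \<and> (\<forall>i<j. W i < m))"

definition first_pos :: "(nat \<Rightarrow> nat) \<Rightarrow> nat \<Rightarrow> nat" where
  "first_pos W m = (LEAST j. W j = m)"

definition rigids :: "nat \<Rightarrow> (nat \<Rightarrow> nat) set" where
  "rigids s = {W. rigid W \<and> (\<forall>j<s. W j = j)}"

text \<open>The type of letters is free, so that one operation acts both on 0-1 words and on finite
  parameter words.\<close>

definition subst :: "'c list \<Rightarrow> (nat \<Rightarrow> nat) \<Rightarrow> 'c list" where
  "subst U W = map (\<lambda>j. U ! W j) [0..<first_pos W (length U)]"

text \<open>A word over the alphabet \<open>{..<s}\<close> with parameters \<open>s, s + 1, \<dots>\<close> is stored with the prefix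
  \<open>[0..<s]\<close>.  Letters then behave like parameters that have already occurred, and substitution
  into a parameter word is composition of functions.\<close>

definition restricted_growth :: "nat list \<Rightarrow> nat \<Rightarrow> bool" where
  "restricted_growth U n \<longleftrightarrow>
     set U \<subseteq> {..<n} \<and> (\<forall>m<n. \<exists>j<length U. U ! j = m \<and> (\<forall>i<j. U ! i < m))"

definition param_words :: "nat \<Rightarrow> nat \<Rightarrow> nat list set" where
  "param_words s k = {U. s \<le> length U \<and> (\<forall>j<s. U ! j = j) \<and> restricted_growth U (s + k)}"

section \<open>First occurrences and composition of rigid maps\<close>

lemma first_pos_eqI: "W j = m \<Longrightarrow> (\<And>i. i < j \<Longrightarrow> W i < m) \<Longrightarrow> first_pos W m = j"
  unfolding first_pos_def by (rule Least_equality) (auto, metis less_irrefl not_le)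

lemma first_pos:
  assumes "rigid W"
  shows "W (first_pos W m) = m" and "i < first_pos W m \<Longrightarrow> W i < m"
proof -
  obtain j where j: "W j = m" "\<And>i. i < j \<Longrightarrow> W i < m"
    using assms unfolding rigid_def by blast
  have "first_pos W m = j" using j by (rule first_pos_eqI)
  then show "W (first_pos W m) = m" and "i < first_pos W m \<Longrightarrow> W i < m" using j by auto
qed

lemma first_pos_less:
  assumes "rigid W" "m < n"
  shows "first_pos W m < first_pos W n"
proof (rule ccontr)
  assume "\<not> ?thesis"
  then consider "first_pos W m = first_pos W n" | "first_pos W n < first_pos W m" by linarith
  then show False
    using first_pos[OF assms(1)] assms(2) by cases (metis less_irrefl, metis less_asym)
qed

lemma first_pos_le:
  assumes "rigid W"
  shows "m \<le> first_pos W m"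
  by (rule strict_mono_imp_increasing) (simp add: strict_mono_def first_pos_less[OF assms])

lemma first_pos_mono: "rigid W \<Longrightarrow> m \<le> n \<Longrightarrow> first_pos W m \<le> first_pos W n"
  using first_pos_less by (metis le_less)

lemma rigid_le:
  assumes "rigid W"
  shows "W j \<le> j"
proof -
  have "first_pos W (W j) \<le> j" unfolding first_pos_def by (rule Least_le) simp
  with first_pos_le[OF assms, of "W j"] show ?thesis by simp
qed

lemma rigid_comp: "rigid X \<Longrightarrow> rigid W \<Longrightarrow> rigid (X \<circ> W)"
  unfolding rigid_def comp_def by metis

lemma first_pos_comp:
  assumes "rigid X" "rigid W"
  shows "first_pos (X \<circ> W) m = first_pos W (first_pos X m)"
  by (rule first_pos_eqI) (use first_pos[OF assms(1)] first_pos[OF assms(2)] in auto)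

lemma rigids_id [simp]: "id \<in> rigids s"
  by (auto simp: rigids_def rigid_def)

lemma rigids_comp: "X \<in> rigids s \<Longrightarrow> W \<in> rigids s \<Longrightarrow> X \<circ> W \<in> rigids s"
  by (auto simp: rigids_def rigid_comp)

lemma rigids_antimono: "X \<in> rigids s \<Longrightarrow> s' \<le> s \<Longrightarrow> X \<in> rigids s'"
  by (auto simp: rigids_def)

lemma rigids_rigid: "X \<in> rigids s \<Longrightarrow> rigid X"
  by (simp add: rigids_def)

lemma first_pos_fixed: "W \<in> rigids s \<Longrightarrow> m < s \<Longrightarrow> first_pos W m = m"
  by (rule first_pos_eqI) (auto simp: rigids_def)

section \<open>Substitution as a right action\<close>

lemma length_subst [simp]: "length (subst U W) = first_pos W (length U)"
  by (simp add: subst_def)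

lemma nth_subst: "j < first_pos W (length U) \<Longrightarrow> subst U W ! j = U ! W j"
  by (simp add: subst_def)

lemma subst_comp:
  assumes "rigid X" "rigid W"
  shows "subst U (X \<circ> W) = subst (subst U X) W"
proof (rule nth_equalityI)
  show "length (subst U (X \<circ> W)) = length (subst (subst U X) W)"
    by (simp add: first_pos_comp assms)
next
  fix j assume "j < length (subst U (X \<circ> W))"
  then have j: "j < first_pos W (first_pos X (length U))" by (simp add: first_pos_comp assms)
  then have "W j < first_pos X (length U)" using first_pos(2)[OF assms(2)] by blast
  then show "subst U (X \<circ> W) ! j = subst (subst U X) W ! j"
    using j by (simp add: nth_subst first_pos_comp assms)
qed

lemma subst_id [simp]: "subst U id = U"
proof -
  have "first_pos id m = m" for m by (rule first_pos_eqI) auto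
  then show ?thesis by (simp add: subst_def map_nth)
qed

text \<open>The strict bound matters: a word of length \<open>s\<close> would be cut at the first
  occurrence of the parameter \<open>s\<close>, which \<open>W\<close> may delay.\<close>

lemma subst_fixed:
  assumes "W \<in> rigids s" "length U < s"
  shows "subst U W = U"
  using assms by (intro nth_equalityI) (auto simp: first_pos_fixed nth_subst rigids_def)

lemma subst_prefix:
  assumes "W \<in> rigids (length u)"
  obtains t' where "subst (u @ t) W = u @ t'"
proof -
  have W: "rigid W" using assms by (rule rigids_rigid)
  have "length u \<le> first_pos W (length (u @ t))"
    using first_pos_le[OF W, of "length (u @ t)"] by simp
  then have "take (length u) (subst (u @ t) W) = u"
    using assms by (intro nth_equalityI) (auto simp: nth_subst rigids_def nth_append)
  then have "subst (u @ t) W = u @ drop (length u) (subst (u @ t) W)"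
    by (metis append_take_drop_id)
  then show ?thesis using that by blast
qed

lemma param_words_subst:
  assumes U: "U \<in> param_words s k" and W: "W \<in> rigids s"
  shows "subst U W \<in> param_words s k"
proof -
  have rW: "rigid W" and fW: "\<And>j. j < s \<Longrightarrow> W j = j" using W by (auto simp: rigids_def)
  have U1: "s \<le> length U" "\<And>j. j < s \<Longrightarrow> U ! j = j" "set U \<subseteq> {..<s + k}"
    and U2: "\<And>m. m < s + k \<Longrightarrow> \<exists>j<length U. U ! j = m \<and> (\<forall>i<j. U ! i < m)"
    using U by (auto simp: param_words_def restricted_growth_def)
  have len: "s \<le> first_pos W (length U)" using first_pos_le[OF rW] U1(1) le_trans by blast
  have "set (subst U W) \<subseteq> {..<s + k}"
  proof
    fix x assume "x \<in> set (subst U W)"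
    then obtain i where "i < first_pos W (length U)" "x = U ! W i" by (auto simp: subst_def)
    then have "x \<in> set U" using first_pos(2)[OF rW] by simp
    then show "x \<in> {..<s + k}" using U1(3) by blast
  qed
  moreover have "\<exists>j<length (subst U W). subst U W ! j = m \<and> (\<forall>i<j. subst U W ! i < m)"
    if m: "m < s + k" for m
  proof -
    obtain j where j: "j < length U" "U ! j = m" "\<And>i. i < j \<Longrightarrow> U ! i < m" using U2[OF m] by blast
    have l: "first_pos W j < first_pos W (length U)" using first_pos_less[OF rW j(1)] .
    show ?thesis
      using l j first_pos[OF rW] by (intro exI[of _ "first_pos W j"]) (auto simp: nth_subst)
  qed
  ultimately show ?thesis
    using len U1 fW by (auto simp: param_words_def restricted_growth_def nth_subst)
qed

section \<open>Words without parameters, and fusion\<close>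

definition words :: "nat \<Rightarrow> nat list set" where
  "words s = {[0..<s] @ t |t. set t \<subseteq> {..<s}}"

lemma wordsI:
  assumes "s \<le> length U" "\<And>j. j < s \<Longrightarrow> U ! j = j" "set U \<subseteq> {..<s}"
  shows "U \<in> words s"
proof -
  have "take s U = [0..<s]" using assms by (intro nth_equalityI) auto
  then have "U = [0..<s] @ drop s U" by (metis append_take_drop_id)
  moreover have "set (drop s U) \<subseteq> {..<s}" using assms(3) set_drop_subset by fast
  ultimately show ?thesis unfolding words_def by blast
qed

lemma param_words_0: "param_words s 0 = words s"
proof (rule set_eqI, rule iffI)
  fix U assume "U \<in> param_words s 0"
  then show "U \<in> words s"
    by (intro wordsI) (auto simp: param_words_def restricted_growth_def)
next
  fix U assume "U \<in> words s"
  then obtain t where t: "U = [0..<s] @ t" "set t \<subseteq> {..<s}" by (auto simp: words_def)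
  have "\<exists>j<length U. U ! j = m \<and> (\<forall>i<j. U ! i < m)" if "m < s" for m
    using that by (intro exI[of _ m]) (simp add: t nth_append)
  then show "U \<in> param_words s 0"
    using t by (auto simp: param_words_def restricted_growth_def nth_append)
qed

lemma words_subst: "u \<in> words s \<Longrightarrow> W \<in> rigids s \<Longrightarrow> subst u W \<in> words s"
  using param_words_subst[of u s 0 W] by (simp add: param_words_0)

lemma wordsD:
  assumes "u \<in> words s"
  shows "s \<le> length u" "set u \<subseteq> {..<s}" "j < s \<Longrightarrow> u ! j = j" "u = [0..<s] @ drop s u"
  using assms by (auto simp: words_def nth_append)

lemma words_append: "u \<in> words s \<Longrightarrow> set t \<subseteq> {..<s} \<Longrightarrow> u @ t \<in> words s"
  by (force simp: words_def)

lemma words_upt [simp]: "[0..<s] \<in> words s"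
  by (force simp: words_def)

lemma words_drop: "u \<in> words s \<Longrightarrow> set (drop s u) \<subseteq> {..<s}"
  by (auto simp: words_def)

lemma finite_words_length: "finite {u \<in> words s. length u = n}"
  by (rule finite_subset[OF _ finite_lists_length_eq[of "{..<s}" n]]) (auto dest: wordsD)

text \<open>Each factor fixes a longer initial segment, so the compositions stabilise pointwise.\<close>

lemma rigid_limit:
  assumes X: "\<And>n. X n \<in> rigids (s + n)"
    and V: "\<And>n. V (Suc n) = X n \<circ> V n" "V 0 = id"
  obtains W where "W \<in> rigids s" "\<And>n. \<exists>Z \<in> rigids (s + n). W = Z \<circ> V n"
proof -
  \<comment> \<open>\<open>C n m\<close> composes the \<open>m\<close> factors that begin with
    \<open>X n\<close>; in particular \<open>C 0 n\<close> is \<open>V n\<close>.\<close>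
  define C where "C n m = rec_nat id (\<lambda>k f. X (n + k) \<circ> f) m" for n m
  have C0: "C n 0 = id" and CS: "C n (Suc m) = X (n + m) \<circ> C n m" for n m
    by (simp_all add: C_def)
  have Cr: "C n m \<in> rigids (s + n)" for n m
  proof (induction m)
    case (Suc m)
    have "X (n + m) \<in> rigids (s + n)" using X[of "n + m"] by (rule rigids_antimono) simp
    then show ?case unfolding CS using Suc by (rule rigids_comp)
  qed (simp only: C0 rigids_id)
  have stable: "C n (m + d) j = C n m j" if "C n m j < s + n + m" for n m d j
  proof (induction d)
    case (Suc d)
    have "C n m j < s + (n + (m + d))" using that by simp
    then have "X (n + (m + d)) (C n m j) = C n m j" using X[of "n + (m + d)"] by (simp add: rigids_def)
    then show ?case using Suc by (simp add: CS)
  qed simp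
  have Cle: "C n m j \<le> j" for n m j using rigid_le rigids_rigid Cr by blast
  \<comment> \<open>A rigid map does not exceed its argument, so after \<open>Suc j\<close> factors
    the value at \<open>j\<close> is so small that all later factors fix it.\<close>
  define Z where "Z n j = C n (Suc j) j" for n j
  have ZC: "Z n j = C n m j" if "j < m" for n m j
  proof -
    have "C n (Suc j) j < s + n + Suc j" using Cle[of n "Suc j" j] by linarith
    from stable[OF this, of "m - Suc j"] that show ?thesis by (simp add: Z_def)
  qed
  have ZC': "Z n j = C n m j" if "C n m j < s + n + m" for n m j
    using ZC[of j "m + Suc j" n] stable[OF that, of "Suc j"] by simp
  have Zr: "Z n \<in> rigids (s + n)" for n
  proof -
    have "\<exists>j. Z n j = v \<and> (\<forall>i<j. Z n i < v)" for v
    proof -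
      \<comment> \<open>After \<open>Suc v\<close> factors the value \<open>v\<close> lies in the
        fixed range, so its first occurrence no longer moves.\<close>
      define m where "m = Suc v"
      have r: "rigid (C n m)" using Cr rigids_rigid by blast
      define j where "j = first_pos (C n m) v"
      have j: "C n m j = v" "\<And>i. i < j \<Longrightarrow> C n m i < v"
        unfolding j_def using first_pos[OF r] by auto
      have "Z n j = v" using ZC'[of n m j] j(1) by (simp add: m_def)
      moreover have "Z n i < v" if "i < j" for i
        using ZC'[of n m i] j(2)[OF that] by (simp add: m_def)
      ultimately show ?thesis by blast
    qed
    moreover have "Z n j = j" if "j < s + n" for j using Cr[of n "Suc j"] that by (simp add: Z_def rigids_def)
    ultimately show ?thesis by (simp add: rigids_def rigid_def)
  qed
  have split: "C 0 (n + m) = C n m \<circ> C 0 n" for n m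
    by (induction m) (simp_all add: C0 CS comp_assoc)
  have CV: "C 0 n = V n" for n by (induction n) (simp_all add: C0 CS V)
  have "Z 0 = Z n \<circ> V n" for n
  proof
    fix j
    define q where "q = Suc (j + V n j)"
    have "Z 0 j = C 0 (n + q) j" by (rule ZC) (simp add: q_def)
    also have "\<dots> = C n q (V n j)" using fun_cong[OF split[of n q], of j] by (simp add: CV)
    also have "\<dots> = Z n (V n j)" by (rule ZC[symmetric]) (simp add: q_def)
    finally show "Z 0 j = (Z n \<circ> V n) j" by simp
  qed
  then show ?thesis using Zr[of 0] Zr by (intro that[of "Z 0"]) auto
qed

text \<open>\<open>Z\<close> fixes the first \<open>s + n\<close> positions. Hence what stage
  \<open>n\<close> decides about words shorter than \<open>s + n\<close> holds for the limit by
  \<open>subst_fixed\<close>, and longer words keep their beginning when traced back through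
  \<open>Z\<close>.\<close>

lemma fusion:
  assumes base: "Inv 0 id"
    and step: "\<And>n W. W \<in> rigids s \<Longrightarrow> Inv n W \<Longrightarrow> \<exists>X \<in> rigids (s + n). Inv (Suc n) (X \<circ> W)"
  obtains W where "W \<in> rigids s"
    "\<And>n. \<exists>V \<in> rigids s. \<exists>Z \<in> rigids (s + n). Inv n V \<and> W = Z \<circ> V"
proof -
  \<comment> \<open>Dependent choice leaves the start open; the clause for \<open>n = 0\<close> pins
    it to the identity.\<close>
  have "\<exists>V. \<forall>n. (V n \<in> rigids s \<and> Inv n (V n) \<and> (n = 0 \<longrightarrow> V n = id)) \<and>
          (\<exists>X \<in> rigids (s + n). V (Suc n) = X \<circ> V n)"
  proof (rule dependent_nat_choice)
    show "\<exists>x. x \<in> rigids s \<and> Inv 0 x \<and> (0 = (0::nat) \<longrightarrow> x = id)" using base by auto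
  next
    fix x n
    assume x: "x \<in> rigids s \<and> Inv n x \<and> (n = 0 \<longrightarrow> x = id)"
    then obtain X where X: "X \<in> rigids (s + n)" "Inv (Suc n) (X \<circ> x)" using step by blast
    then have "X \<circ> x \<in> rigids s" using x by (meson le_add1 rigids_antimono rigids_comp)
    with X show "\<exists>y. (y \<in> rigids s \<and> Inv (Suc n) y \<and> (Suc n = 0 \<longrightarrow> y = id)) \<and>
        (\<exists>X \<in> rigids (s + n). y = X \<circ> x)" by blast
  qed
  then obtain V where V: "\<And>n. V n \<in> rigids s" "\<And>n. Inv n (V n)" "V 0 = id"
    and VX: "\<And>n. \<exists>X \<in> rigids (s + n). V (Suc n) = X \<circ> V n" by auto
  obtain X where X: "\<And>n. X n \<in> rigids (s + n)" "\<And>n. V (Suc n) = X n \<circ> V n"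
    using VX by metis
  obtain W where "W \<in> rigids s" "\<And>n. \<exists>Z \<in> rigids (s + n). W = Z \<circ> V n"
    using rigid_limit[OF X V(3)] by metis
  then show ?thesis using V by (intro that) blast+
qed

text \<open>The map \<open>X\<close>, started at position \<open>m\<close> instead of \<open>k\<close>: the letter \<open>c < k\<close> is read off at
  position \<open>\<sigma> c\<close> of the new prefix.\<close>

definition shift :: "nat \<Rightarrow> nat \<Rightarrow> (nat \<Rightarrow> nat) \<Rightarrow> (nat \<Rightarrow> nat) \<Rightarrow> nat \<Rightarrow> nat" where
  "shift k m \<sigma> X j = (if j < m then j
     else let c = X (j - m + k) in if c < k then \<sigma> c else c - k + m)"

lemma shift_add: "shift k m \<sigma> X (i + m) = (if X (i + k) < k then \<sigma> (X (i + k)) else X (i + k) - k + m)"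
  by (simp add: shift_def Let_def)

lemma first_pos_shift:
  assumes X: "X \<in> rigids k" and \<sigma>: "\<And>c. c < k \<Longrightarrow> \<sigma> c < m" and "m \<le> v"
  shows "first_pos (shift k m \<sigma> X) v = first_pos X (v - m + k) - k + m"
    and "shift k m \<sigma> X (first_pos X (v - m + k) - k + m) = v"
    and "\<And>i. i < first_pos X (v - m + k) - k + m \<Longrightarrow> shift k m \<sigma> X i < v"
proof -
  define j where "j = first_pos X (v - m + k)"
  have r: "rigid X" using X by (rule rigids_rigid)
  have kj: "k \<le> j" using first_pos_le[OF r, of "v - m + k"] by (simp add: j_def)
  have Xj: "X j = v - m + k" "\<And>i. i < j \<Longrightarrow> X i < v - m + k"
    using first_pos[OF r] by (auto simp: j_def)
  show 1: "shift k m \<sigma> X (first_pos X (v - m + k) - k + m) = v"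
    unfolding j_def[symmetric] shift_add using Xj(1) kj \<open>m \<le> v\<close> by auto
  show 2: "shift k m \<sigma> X i < v" if "i < first_pos X (v - m + k) - k + m" for i
  proof (cases "i < m")
    case False
    then have "X (i - m + k) < v - m + k" using that kj unfolding j_def[symmetric] by (intro Xj(2)) simp
    then show ?thesis using False \<sigma>[of "X (i - m + k)"] \<open>m \<le> v\<close> by (auto simp: shift_def Let_def)
  qed (use \<open>m \<le> v\<close> in \<open>simp add: shift_def\<close>)
  show "first_pos (shift k m \<sigma> X) v = first_pos X (v - m + k) - k + m"
    using 1 2 by (rule first_pos_eqI)
qed

lemma shift_rigids:
  assumes "X \<in> rigids k" "\<And>c. c < k \<Longrightarrow> \<sigma> c < m"
  shows "shift k m \<sigma> X \<in> rigids m"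
proof -
  have "\<exists>j. shift k m \<sigma> X j = v \<and> (\<forall>i<j. shift k m \<sigma> X i < v)" for v
  proof (cases "v < m")
    case True
    then show ?thesis by (intro exI[of _ v]) (simp add: shift_def)
  next
    case False
    then show ?thesis using first_pos_shift(2,3)[OF assms, where v=v] by (meson not_less)
  qed
  then show ?thesis by (simp add: rigids_def rigid_def) (simp add: shift_def)
qed

text \<open>Keeps the stem \<open>u\<close> and lets \<open>X\<close> act behind it, where
  \<open>e\<close> lists the letters that \<open>X\<close> sees in place of \<open>u\<close>. A
  refinement found for the short stem \<open>e\<close> thus works behind all stems of length
  \<open>m\<close> with these letters at once.\<close>

lemma subst_shift:
  assumes X: "X \<in> rigids k" and \<sigma>: "\<And>c. c < k \<Longrightarrow> \<sigma> c < m"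
    and "length u = m" "length e = k" and e: "\<And>c. c < k \<Longrightarrow> e ! c = u ! \<sigma> c"
  shows "subst (u @ t) (shift k m \<sigma> X) = u @ drop k (subst (e @ t) X)"
proof (rule nth_equalityI)
  let ?P = "first_pos X (length t + k)"
  have r: "rigid X" using X by (rule rigids_rigid)
  have kP: "k \<le> ?P" using first_pos_le[OF r, of "length t + k"] by simp
  have len: "first_pos (shift k m \<sigma> X) (m + length t) = ?P - k + m"
    using first_pos_shift(1)[OF X \<sigma>, where v="m + length t"] by simp
  then show "length (subst (u @ t) (shift k m \<sigma> X)) = length (u @ drop k (subst (e @ t) X))"
    using assms by (simp add: add.commute)
  fix j assume "j < length (subst (u @ t) (shift k m \<sigma> X))"
  then have j: "j < ?P - k + m" using len assms by simp
  have "subst (u @ t) (shift k m \<sigma> X) ! j = (u @ t) ! shift k m \<sigma> X j"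
    using j len assms by (simp add: nth_subst)
  also have "\<dots> = (u @ drop k (subst (e @ t) X)) ! j"
  proof (cases "j < m")
    case True
    then show ?thesis using assms by (simp add: shift_def nth_append)
  next
    case False
    define c where "c = X (j - m + k)"
    have jP: "j - m + k < ?P" using j False kP by simp
    have "(u @ drop k (subst (e @ t) X)) ! j = subst (e @ t) X ! (j - m + k)"
      using False assms jP by (simp add: nth_append add.commute)
    also have "\<dots> = (e @ t) ! c" using jP assms by (simp add: nth_subst c_def add.commute)
    also have "\<dots> = (u @ t) ! shift k m \<sigma> X j"
      using False assms \<sigma>[of c] shift_add[of k m \<sigma> X "j - m"] unfolding c_def[symmetric]
      by (auto simp: nth_append)
    finally show ?thesis by simp
  qed
  finally show "subst (u @ t) (shift k m \<sigma> X) ! j = (u @ drop k (subst (e @ t) X)) ! j" .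
qed

text \<open>Counterpart of \<open>shift\<close>: it rewrites the stem and leaves the tail alone, as
  \<open>subst_prepend\<close> shows.\<close>

definition prepend :: "nat list \<Rightarrow> nat \<Rightarrow> nat \<Rightarrow> nat" where
  "prepend L m j = (if j < length L then L ! j else j - length L + m)"

lemma first_pos_prepend:
  assumes "restricted_growth L m"
  shows "first_pos (prepend L m) (m + d) = length L + d"
proof (rule first_pos_eqI)
  fix i assume "i < length L + d"
  moreover have "i < length L \<Longrightarrow> L ! i < m"
    using assms nth_mem[of i L] unfolding restricted_growth_def by blast
  ultimately show "prepend L m i < m + d" by (auto simp: prepend_def)
qed (simp add: prepend_def)

lemma prepend_rigids:
  assumes L: "L \<in> param_words s k"
  shows "prepend L (s + k) \<in> rigids s"
proof -
  have g: "restricted_growth L (s + k)" using L by (simp add: param_words_def)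
  have "\<exists>j. prepend L (s + k) j = v \<and> (\<forall>i<j. prepend L (s + k) i < v)" for v
  proof (cases "v < s + k")
    case True
    then obtain j where "j < length L" "L ! j = v" "\<forall>i<j. L ! i < v"
      using g unfolding restricted_growth_def by blast
    then show ?thesis by (intro exI[of _ j]) (simp add: prepend_def)
  next
    case False
    then have "v = s + k + (v - (s + k))" by simp
    moreover have "prepend L (s + k) i < s + k + d" if "i < length L + d" for i d
    proof -
      have "i < length L \<Longrightarrow> L ! i < s + k"
        using g nth_mem[of i L] unfolding restricted_growth_def by blast
      then show ?thesis using that by (auto simp: prepend_def)
    qed
    moreover have "prepend L (s + k) (length L + d) = s + k + d" for d by (simp add: prepend_def)
    ultimately show ?thesis by metis
  qed
  then show ?thesis using L by (auto simp: rigids_def rigid_def prepend_def param_words_def)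
qed

lemma subst_prepend:
  assumes "restricted_growth L m" "length e = m"
  shows "subst (e @ t) (prepend L m) = map ((!) e) L @ t"
proof (rule nth_equalityI)
  show "length (subst (e @ t) (prepend L m)) = length (map ((!) e) L @ t)"
    using assms by (simp add: first_pos_prepend)
  fix j assume "j < length (subst (e @ t) (prepend L m))"
  then have j: "j < length L + length t" using assms by (simp add: first_pos_prepend)
  moreover have "j < length L \<Longrightarrow> L ! j < m"
    using assms nth_mem[of j L] unfolding restricted_growth_def by blast
  ultimately show "subst (e @ t) (prepend L m) ! j = (map ((!) e) L @ t) ! j"
    using assms by (auto simp: nth_subst first_pos_prepend prepend_def nth_append)
qed

section \<open>The Hales-Jewett theorem\<close>

definition cube :: "nat \<Rightarrow> nat \<Rightarrow> nat list set" where
  "cube s N = {u. set u \<subseteq> {..<s} \<and> length u = N}"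

text \<open>The symbol \<open>s\<close>, the first one outside the alphabet, is the variable; these
  words are the combinatorial lines of \<open>cube s N\<close>.\<close>

definition var_words :: "nat \<Rightarrow> nat \<Rightarrow> nat list set" where
  "var_words s N = {z. set z \<subseteq> {..s} \<and> length z = N \<and> s \<in> set z}"

definition inst :: "nat \<Rightarrow> nat \<Rightarrow> nat list \<Rightarrow> nat list" where
  "inst s c z = map (\<lambda>x. if x = s then c else x) z"

definition hj :: "nat \<Rightarrow> bool" where
  "hj s \<longleftrightarrow> (\<forall>r. \<exists>N. \<forall>\<chi> :: nat list \<Rightarrow> nat. \<chi> ` cube s N \<subseteq> {..<r} \<longrightarrow>
     (\<exists>z \<in> var_words s N. \<exists>d. \<forall>c<s. \<chi> (inst s c z) = d))"

lemma finite_cube: "finite (cube s N)"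
  unfolding cube_def by (rule finite_lists_length_eq) simp

lemma finite_var_words: "finite (var_words s N)"
  by (rule finite_subset[OF _ finite_lists_length_eq[of "{..s}" N]]) (auto simp: var_words_def)

lemma inst_cube: "z \<in> var_words s N \<Longrightarrow> c < s \<Longrightarrow> inst s c z \<in> cube s N"
  unfolding var_words_def inst_def cube_def by (auto simp: subset_iff le_less)

lemma inst_append: "inst s c (y @ z) = inst s c y @ inst s c z"
  by (simp add: inst_def)

lemma inst_trivial: "set y \<subseteq> {..<s} \<Longrightarrow> inst s c y = y"
  by (induction y) (auto simp: inst_def)

text \<open>The applications colour by lists of colours and by stems, whereas \<open>hj\<close>
  speaks of numbers.\<close>

lemma hj_finite:
  fixes K :: "'c set"
  assumes "hj s" "finite K"
  shows "\<exists>N. \<forall>\<chi> :: nat list \<Rightarrow> 'c. \<chi> ` cube s N \<subseteq> K \<longrightarrow>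
     (\<exists>z \<in> var_words s N. \<forall>c<s. \<forall>c'<s. \<chi> (inst s c z) = \<chi> (inst s c' z))"
proof -
  obtain f where f: "bij_betw f K {..<card K}"
    using ex_bij_betw_finite_nat[OF assms(2)] by (auto simp: atLeast0LessThan)
  obtain N where N: "\<And>\<chi> :: nat list \<Rightarrow> nat. \<chi> ` cube s N \<subseteq> {..<card K} \<Longrightarrow>
     \<exists>z \<in> var_words s N. \<exists>d. \<forall>c<s. \<chi> (inst s c z) = d"
    using assms(1) unfolding hj_def by blast
  show ?thesis
  proof (intro exI[of _ N] allI impI)
    fix \<chi> :: "nat list \<Rightarrow> 'c" assume \<chi>: "\<chi> ` cube s N \<subseteq> K"
    then have "(f \<circ> \<chi>) ` cube s N \<subseteq> {..<card K}" using f by (auto simp: bij_betw_def)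
    from N[OF this] obtain z d where z: "z \<in> var_words s N" "\<And>c. c < s \<Longrightarrow> f (\<chi> (inst s c z)) = d"
      by auto
    have "\<chi> (inst s c z) = \<chi> (inst s c' z)" if "c < s" "c' < s" for c c'
    proof -
      have "\<chi> (inst s c z) \<in> K" "\<chi> (inst s c' z) \<in> K" using inst_cube[OF z(1)] that \<chi> by auto
      moreover have "f (\<chi> (inst s c z)) = f (\<chi> (inst s c' z))" using z(2) that by simp
      ultimately show ?thesis using f unfolding bij_betw_def by (meson inj_onD)
    qed
    then show "\<exists>z \<in> var_words s N. \<forall>c<s. \<forall>c'<s. \<chi> (inst s c z) = \<chi> (inst s c' z)"
      using z(1) by blast
  qed
qed

text \<open>Colour focusing: either a line is monochromatic, or \<open>k\<close> lines over the letters below \<open>s\<close>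
  with pairwise distinct colours meet in one point when their variable is set to \<open>s\<close>.\<close>

lemma hj_focus:
  assumes "hj s" "0 < s"
  shows "\<exists>N. \<forall>\<chi> :: nat list \<Rightarrow> nat. \<chi> ` cube (Suc s) N \<subseteq> {..<r} \<longrightarrow>
     (\<exists>z \<in> var_words (Suc s) N. \<exists>d. \<forall>c<Suc s. \<chi> (inst (Suc s) c z) = d) \<or>
     (\<exists>f \<in> cube (Suc s) N. \<exists>Z col. inj_on col {..<k::nat} \<and>
        (\<forall>i<k. Z i \<in> var_words (Suc s) N \<and> inst (Suc s) s (Z i) = f \<and>
           (\<forall>c<s. \<chi> (inst (Suc s) c (Z i)) = (col i :: nat))))"
proof (induction k)
  case 0
  show ?case by (intro exI[of _ 0]) (auto simp: cube_def)
next
  case (Suc k)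
  let ?S = "Suc s"
  obtain N where N: "\<And>\<chi> :: nat list \<Rightarrow> nat. \<chi> ` cube ?S N \<subseteq> {..<r} \<Longrightarrow>
     (\<exists>z \<in> var_words ?S N. \<exists>d. \<forall>c<?S. \<chi> (inst ?S c z) = d) \<or>
     (\<exists>f \<in> cube ?S N. \<exists>Z col. inj_on col {..<k::nat} \<and>
        (\<forall>i<k. Z i \<in> var_words ?S N \<and> inst ?S s (Z i) = f \<and>
           (\<forall>c<s. \<chi> (inst ?S c (Z i)) = (col i :: nat))))"
    using Suc by blast
  \<comment> \<open>The colour given to \<open>y\<close> is the whole colouring of
    \<open>cube ?S N\<close> behind \<open>y\<close>, stored as a list along
    \<open>xs\<close>.\<close>
  obtain xs where xs: "set xs = cube ?S N" using finite_list[OF finite_cube] by blast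
  let ?K = "{l. set l \<subseteq> {..<r} \<and> length l = length xs}"
  have "finite ?K" by (rule finite_lists_length_eq) simp
  from hj_finite[OF assms(1) this] obtain M where M: "\<And>\<chi>. \<chi> ` cube s M \<subseteq> ?K \<Longrightarrow>
     \<exists>z \<in> var_words s M. \<forall>c<s. \<forall>c'<s. \<chi> (inst s c z) = \<chi> (inst s c' z)" by blast
  show ?case
  proof (intro exI[of _ "M + N"] allI impI)
    fix \<chi> :: "nat list \<Rightarrow> nat" assume \<chi>: "\<chi> ` cube ?S (M + N) \<subseteq> {..<r}"
    let ?mono = "\<exists>z \<in> var_words ?S (M + N). \<exists>d. \<forall>c<?S. \<chi> (inst ?S c z) = d"
    have app: "y @ x \<in> cube ?S (M + N)" if "y \<in> cube ?S M" "x \<in> cube ?S N" for x y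
      using that by (auto simp: cube_def)
    have up: "y \<in> cube ?S M" if "y \<in> cube s M" for y using that by (auto simp: cube_def)
    have "(\<lambda>y. map (\<lambda>x. \<chi> (y @ x)) xs) ` cube s M \<subseteq> ?K"
      using app up \<chi> xs by fastforce
    from M[OF this] obtain y where y: "y \<in> var_words s M"
      and yc: "\<And>c c'. c < s \<Longrightarrow> c' < s \<Longrightarrow> map (\<lambda>x. \<chi> (inst s c y @ x)) xs = map (\<lambda>x. \<chi> (inst s c' y @ x)) xs"
      by blast
    define y0 where "y0 = inst s 0 y"
    have y0: "y0 \<in> cube s M" unfolding y0_def by (rule inst_cube[OF y \<open>0 < s\<close>])
    have yx: "\<chi> (inst s c y @ x) = \<chi> (y0 @ x)" if "c < s" "x \<in> cube ?S N" for c x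
      using yc[OF that(1) \<open>0 < s\<close>] that(2) xs by (simp add: y0_def)
    have y0S: "inst ?S c y0 = y0" for c using y0 by (intro inst_trivial) (auto simp: cube_def)
    \<comment> \<open>In the larger alphabet \<open>s\<close> is a letter, so the variable of
      \<open>y\<close> is renamed to \<open>?S\<close>. Setting it to \<open>s\<close> gives back
      \<open>y\<close>, which makes \<open>y @ f\<close> the new focus.\<close>
    define y' where "y' = inst s ?S y"
    have y'v: "set y' \<subseteq> {..?S}" "length y' = M" "?S \<in> set y'"
      using y by (auto simp: y'_def inst_def var_words_def)
    have y'i: "inst ?S c y' = inst s c y" for c
      using y unfolding y'_def inst_def var_words_def by (auto simp: in_mono)
    have ys: "inst s s y = y" by (simp add: inst_def map_idI)
    have "(\<lambda>x. \<chi> (y0 @ x)) ` cube ?S N \<subseteq> {..<r}" using app up y0 \<chi> by blast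
    from N[OF this]
    consider (mono) z d where "z \<in> var_words ?S N" "\<And>c. c < ?S \<Longrightarrow> \<chi> (y0 @ inst ?S c z) = d"
      | (focus) f Z col where "f \<in> cube ?S N" "inj_on col {..<k}"
        "\<And>i. i < k \<Longrightarrow> Z i \<in> var_words ?S N" "\<And>i. i < k \<Longrightarrow> inst ?S s (Z i) = f"
        "\<And>i c. i < k \<Longrightarrow> c < s \<Longrightarrow> \<chi> (y0 @ inst ?S c (Z i)) = col i"
      by blast
    then show "?mono \<or> (\<exists>f \<in> cube ?S (M + N). \<exists>Z col. inj_on col {..<Suc k} \<and>
        (\<forall>i<Suc k. Z i \<in> var_words ?S (M + N) \<and> inst ?S s (Z i) = f \<and>
           (\<forall>c<s. \<chi> (inst ?S c (Z i)) = (col i :: nat))))"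
    proof cases
      case mono
      have "y0 @ z \<in> var_words ?S (M + N)" using mono(1) y0 by (auto simp: cube_def var_words_def)
      moreover have "\<forall>c<?S. \<chi> (inst ?S c (y0 @ z)) = d" using mono(2) by (simp add: inst_append y0S)
      ultimately show ?thesis by blast
    next
      case focus
      have fS: "inst ?S c f = f" for c using focus(1) by (intro inst_trivial) (auto simp: cube_def)
      show ?thesis
      proof (cases "\<exists>i<k. \<chi> (y0 @ f) = col i")
        case True
        \<comment> \<open>The focus provides the missing letter \<open>s\<close> of the line
          \<open>Z i\<close>.\<close>
        then obtain i where i: "i < k" "\<chi> (y0 @ f) = col i" by blast
        have "y0 @ Z i \<in> var_words ?S (M + N)" using focus(3)[OF i(1)] y0
          by (auto simp: cube_def var_words_def)
        moreover have "\<chi> (inst ?S c (y0 @ Z i)) = col i" if "c < ?S" for c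
          using focus(4,5)[OF i(1)] i(2) that by (cases "c = s") (simp_all add: inst_append y0S)
        ultimately show ?thesis by blast
      next
        case False
        \<comment> \<open>The old lines keep their colours behind \<open>y'\<close>; the additional
          line \<open>y' @ f\<close> has the colour of \<open>y0 @ f\<close>, which is new.\<close>
        define Z' where "Z' i = y' @ (if i = k then f else Z i)" for i
        define col' where "col' = col(k := \<chi> (y0 @ f))"
        have "y @ f \<in> cube ?S (M + N)" using y focus(1)
          by (fastforce simp: cube_def var_words_def)
        moreover have "inj_on col' {..<Suc k}"
          using focus(2) False by (force simp: col'_def inj_on_def less_Suc_eq)
        moreover have "Z' i \<in> var_words ?S (M + N)" if "i < Suc k" for i
        proof (cases "i = k")
          case True
          then show ?thesis using y'v focus(1) by (fastforce simp: Z'_def cube_def var_words_def)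
        next
          case False
          then show ?thesis using y'v focus(3)[of i] that by (auto simp: Z'_def var_words_def)
        qed
        moreover have "inst ?S s (Z' i) = y @ f" if "i < Suc k" for i
          using focus(4)[of i] that fS by (cases "i = k") (simp_all add: Z'_def inst_append y'i ys)
        moreover have "\<chi> (inst ?S c (Z' i)) = col' i" if "i < Suc k" "c < s" for i c
        proof (cases "i = k")
          case True
          then show ?thesis using yx[OF that(2) focus(1)] fS
            by (simp add: Z'_def inst_append y'i col'_def)
        next
          case False
          then have i: "i < k" using that by simp
          have "inst ?S c (Z i) \<in> cube ?S N" using inst_cube[OF focus(3)[OF i]] that by simp
          then show ?thesis using yx[OF that(2)] focus(5)[OF i that(2)] False
            by (simp add: Z'_def inst_append y'i col'_def)
        qed
        ultimately show ?thesis by blast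
      qed
    qed
  qed
qed

theorem hales_jewett: "0 < s \<Longrightarrow> hj s"
proof (induction s rule: nat_induct_non_zero)
  case 1
  have "[1] \<in> var_words 1 1" by (simp add: var_words_def)
  then have "\<exists>z \<in> var_words 1 1. \<exists>d. \<forall>c<1. \<chi> (inst 1 c z) = d" for \<chi> :: "nat list \<Rightarrow> nat"
    by auto
  then show ?case unfolding hj_def by blast
next
  case (Suc s)
  show ?case unfolding hj_def
  proof
    fix r
    \<comment> \<open>Asking for \<open>Suc r\<close> lines of distinct colours rules out the
      focusing alternative, since only \<open>r\<close> colours exist.\<close>
    obtain N where N: "\<And>\<chi> :: nat list \<Rightarrow> nat. \<chi> ` cube (Suc s) N \<subseteq> {..<r} \<Longrightarrow>
     (\<exists>z \<in> var_words (Suc s) N. \<exists>d. \<forall>c<Suc s. \<chi> (inst (Suc s) c z) = d) \<or>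
     (\<exists>f \<in> cube (Suc s) N. \<exists>Z col. inj_on col {..<Suc r} \<and>
        (\<forall>i<Suc r. Z i \<in> var_words (Suc s) N \<and> inst (Suc s) s (Z i) = f \<and>
           (\<forall>c<s. \<chi> (inst (Suc s) c (Z i)) = (col i :: nat))))"
      using hj_focus[OF Suc(2,1), of r "Suc r"] by blast
    have "\<exists>z \<in> var_words (Suc s) N. \<exists>d. \<forall>c<Suc s. \<chi> (inst (Suc s) c z) = d"
      if \<chi>: "\<chi> ` cube (Suc s) N \<subseteq> {..<r}" for \<chi> :: "nat list \<Rightarrow> nat"
    proof (rule ccontr)
      assume "\<not> ?thesis"
      then obtain Z and col :: "nat \<Rightarrow> nat" where inj: "inj_on col {..<Suc r}"
        and Z: "\<And>i. i < Suc r \<Longrightarrow> Z i \<in> var_words (Suc s) N"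
          "\<And>i. i < Suc r \<Longrightarrow> \<chi> (inst (Suc s) 0 (Z i)) = col i"
        using N[OF \<chi>] Suc(1) by blast
      have "col ` {..<Suc r} \<subseteq> {..<r}"
      proof
        fix x assume "x \<in> col ` {..<Suc r}"
        then obtain i where i: "i < Suc r" "x = col i" by auto
        then show "x \<in> {..<r}" using Z(2)[OF i(1)] inst_cube[OF Z(1)[OF i(1)], of 0] \<chi> by auto
      qed
      from card_inj_on_le[OF inj this] show False by simp
    qed
    then show "\<exists>N. \<forall>\<chi> :: nat list \<Rightarrow> nat. \<chi> ` cube (Suc s) N \<subseteq> {..<r} \<longrightarrow>
     (\<exists>z \<in> var_words (Suc s) N. \<exists>d. \<forall>c<Suc s. \<chi> (inst (Suc s) c z) = d)" by blast
  qed
qed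

section \<open>Words without parameters\<close>

text \<open>A rigid map stands for an infinite-dimensional subspace, whose points are its instances;
  a set is large if it meets every subspace.\<close>

definition large :: "nat \<Rightarrow> nat list set \<Rightarrow> bool" where
  "large s C \<longleftrightarrow> (\<forall>Y \<in> rigids s. \<exists>t \<in> words s. subst t Y \<in> C)"

lemma large_mono: "large s C \<Longrightarrow> (\<And>t. t \<in> words s \<Longrightarrow> t \<in> C \<Longrightarrow> t \<in> C') \<Longrightarrow> large s C'"
  unfolding large_def using words_subst by blast

text \<open>If no piece became large on any subspace, one could avoid the pieces one after another
  by passing to smaller subspaces, and the last subspace would avoid all of them.\<close>

lemma large_partition:
  assumes "finite I" and cov: "\<And>t. t \<in> words s \<Longrightarrow> \<exists>i \<in> I. t \<in> C i"
  shows "\<exists>X \<in> rigids s. \<exists>i \<in> I. large s {t \<in> words s. subst t X \<in> C i}"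
proof (rule ccontr)
  assume neg: "\<not> ?thesis"
  have "J \<subseteq> I \<Longrightarrow> \<exists>Y \<in> rigids s. \<forall>t \<in> words s. \<forall>i \<in> J. subst t Y \<notin> C i" if "finite J" for J
    using that
  proof (induction J rule: finite_induct)
    case empty
    then show ?case using rigids_id by blast
  next
    case (insert i J)
    then obtain Y where Y: "Y \<in> rigids s" "\<And>t j. t \<in> words s \<Longrightarrow> j \<in> J \<Longrightarrow> subst t Y \<notin> C j"
      by auto
    have "\<not> large s {t \<in> words s. subst t Y \<in> C i}" using neg Y(1) insert by blast
    then obtain Y' where Y': "Y' \<in> rigids s" "\<And>t. t \<in> words s \<Longrightarrow> subst (subst t Y') Y \<notin> C i"
      unfolding large_def using words_subst by blast
    have "subst t (Y' \<circ> Y) \<notin> C j" if "t \<in> words s" "j \<in> insert i J" for t j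
      using that Y' Y(2)[OF words_subst[OF that(1) Y'(1)]]
      by (auto simp: subst_comp[OF rigids_rigid[OF Y'(1)] rigids_rigid[OF Y(1)]])
    then show ?case using rigids_comp[OF Y'(1) Y(1)] by blast
  qed
  from this[OF \<open>finite I\<close>] obtain Y where "Y \<in> rigids s" "\<And>t i. t \<in> words s \<Longrightarrow> i \<in> I \<Longrightarrow> subst t Y \<notin> C i"
    by auto
  then show False using cov words_upt words_subst by blast
qed

lemma param_words_snoc:
  assumes "L \<in> param_words s n" "set t \<subseteq> {..<s}"
  shows "L @ t @ [s + n] \<in> param_words s (Suc n)"
proof -
  have L: "s \<le> length L" "\<And>j. j < s \<Longrightarrow> L ! j = j" "set L \<subseteq> {..<s + n}"
    and g: "\<And>m. m < s + n \<Longrightarrow> \<exists>j<length L. L ! j = m \<and> (\<forall>i<j. L ! i < m)"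
    using assms(1) by (auto simp: param_words_def restricted_growth_def)
  have "\<exists>j<length (L @ t @ [s + n]). (L @ t @ [s + n]) ! j = m \<and> (\<forall>i<j. (L @ t @ [s + n]) ! i < m)"
    if m: "m < s + Suc n" for m
  proof (cases "m = s + n")
    case True
    have "(L @ t) ! i < s + n" if "i < length (L @ t)" for i
    proof -
      have "(L @ t) ! i \<in> set (L @ t)" using that by (rule nth_mem)
      then show ?thesis using L(3) assms(2) by auto
    qed
    moreover have "(L @ t @ [s + n]) ! i = (L @ t) ! i" if "i < length (L @ t)" for i
      using that by (simp add: nth_append flip: append_assoc)
    moreover have "(L @ t @ [s + n]) ! (length (L @ t)) = s + n" by (simp add: nth_append)
    ultimately show ?thesis using True by (intro exI[of _ "length (L @ t)"]) auto
  next
    case False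
    then obtain j where "j < length L" "L ! j = m" "\<And>i. i < j \<Longrightarrow> L ! i < m" using g[of m] m by auto
    then show ?thesis by (intro exI[of _ j]) (simp add: nth_append)
  qed
  moreover have "set (L @ t @ [s + n]) \<subseteq> {..<s + Suc n}" using L(3) assms(2) by auto
  ultimately show ?thesis using L(1,2) by (auto simp: param_words_def restricted_growth_def nth_append)
qed

lemma param_words_append:
  assumes K: "K \<in> param_words s k" and b: "set b \<subseteq> {..<s + k}"
  shows "K @ b \<in> param_words s k"
proof -
  have "\<exists>j<length (K @ b). (K @ b) ! j = m \<and> (\<forall>i<j. (K @ b) ! i < m)" if "m < s + k" for m
  proof -
    have "\<exists>j<length K. K ! j = m \<and> (\<forall>i<j. K ! i < m)"
      using K that by (simp add: param_words_def restricted_growth_def)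
    then obtain j where "j < length K" "K ! j = m" "\<forall>i<j. K ! i < m" by blast
    then show ?thesis by (intro exI[of _ j]) (simp add: nth_append)
  qed
  then show ?thesis using K b by (auto simp: param_words_def restricted_growth_def nth_append)
qed

lemma map_nth_letters: "u \<in> words s \<Longrightarrow> set x \<subseteq> {..<s} \<Longrightarrow> map ((!) u) x = x"
  by (rule map_idI) (auto intro: wordsD(3))

text \<open>If no finite \<open>E\<close> worked, one could extend a parameter word step by step so as to avoid \<open>C\<close>.\<close>

lemma large_cover:
  assumes "large s C"
  shows "\<exists>E. finite E \<and> E \<subseteq> words s \<and> (\<forall>t. set t \<subseteq> {..<s} \<longrightarrow> (\<exists>e \<in> E. e @ t \<in> C))"
proof (rule ccontr)
  assume neg: "\<not> ?thesis"
  have "\<exists>t. set t \<subseteq> {..<s} \<and> (\<forall>e\<in>E. e @ t \<notin> C)" if "finite E" "E \<subseteq> words s" for E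
    using neg that by auto
  then obtain T where T: "\<And>E. finite E \<Longrightarrow> E \<subseteq> words s \<Longrightarrow> set (T E) \<subseteq> {..<s}"
    "\<And>E e. finite E \<Longrightarrow> E \<subseteq> words s \<Longrightarrow> e \<in> E \<Longrightarrow> e @ T E \<notin> C" by metis
  \<comment> \<open>All instances of the word built so far. They are finitely many, so one tail
    \<open>T\<close> is bad behind every one of them.\<close>
  define img where "img n L = (\<lambda>u. map ((!) u) L) ` {u \<in> words s. length u = s + n}"
    for n :: nat and L
  define L where "L n = rec_nat [0..<s] (\<lambda>n L. L @ T (img n L) @ [s + n]) n" for n
  define M where "M n = L n @ T (img n (L n))" for n
  have L0: "L 0 = [0..<s]" and LS: "L (Suc n) = M n @ [s + n]" for n
    by (simp_all add: L_def M_def)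
  have img: "finite (img n K)" "img n K \<subseteq> words s" if K: "K \<in> param_words s n" for n K
  proof -
    show "finite (img n K)" unfolding img_def using finite_words_length by (rule finite_imageI)
    have "map ((!) u) K \<in> words s" if u: "u \<in> words s" "length u = s + n" for u
    proof (rule wordsI)
      have "u ! x < s" if "x \<in> set K" for x
      proof -
        have "x < length u" using that K u(2) by (auto simp: param_words_def restricted_growth_def)
        then show ?thesis using wordsD(2)[OF u(1)] nth_mem by blast
      qed
      then show "set (map ((!) u) K) \<subseteq> {..<s}" by auto
    qed (use K wordsD(3)[OF u(1)] in \<open>auto simp: param_words_def\<close>)
    then show "img n K \<subseteq> words s" by (auto simp: img_def)
  qed
  have Lp: "L n \<in> param_words s n" for n
  proof (induction n)
    case 0
    show ?case by (simp add: L0 param_words_0)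
  next
    case (Suc n)
    then show ?case using param_words_snoc[OF Suc T(1)[OF img[OF Suc]]] by (simp add: LS M_def)
  qed
  have TL: "set (T (img n (L n))) \<subseteq> {..<s}" for n using T(1) img[OF Lp] .
  have Ml: "M n ! i < s + n" if "i < length (M n)" for i n
  proof -
    have "M n ! i \<in> set (M n)" using that by (rule nth_mem)
    then show ?thesis using Lp[of n] TL[of n] by (auto simp: M_def param_words_def restricted_growth_def)
  qed
  have pre: "length (L n) \<le> length (L (n + d)) \<and> (j < length (L n) \<longrightarrow> L (n + d) ! j = L n ! j)" for n d j
    by (induction d) (auto simp: LS M_def nth_append)
  have len: "n \<le> length (L n)" for n by (induction n) (auto simp: LS M_def)
  define Y where "Y j = L (Suc j) ! j" for j
  have YL: "Y j = L n ! j" if "j < length (L n)" for j n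
  proof -
    have "j < length (L (Suc j))" using len[of "Suc j"] by simp
    then have "L (Suc j + n) ! j = L (Suc j) ! j" using pre by blast
    moreover have "L (n + Suc j) ! j = L n ! j" using that pre by blast
    ultimately show ?thesis by (simp add: Y_def add.commute)
  qed
  have YM: "Y (length (M n)) = s + n" for n
    using YL[of "length (M n)" "Suc n"] by (simp add: LS)
  have YMi: "Y i = M n ! i" if "i < length (M n)" for i n
    using YL[of i "Suc n"] that by (simp add: LS nth_append)
  have Yid: "Y j = j" if "j < s" for j using YL[of j 0] that by (simp add: L0)
  have "\<exists>j. Y j = v \<and> (\<forall>i<j. Y i < v)" for v
  proof (cases "v < s")
    case True
    then show ?thesis using Yid by (intro exI[of _ v]) auto
  next
    case False
    then obtain n where "v = s + n" by (metis le_Suc_ex not_less)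
    then show ?thesis using YM[of n] YMi[of _ n] Ml[of _ n] by (intro exI[of _ "length (M n)"]) auto
  qed
  then have "Y \<in> rigids s" using Yid by (simp add: rigids_def rigid_def)
  then obtain t where t: "t \<in> words s" "subst t Y \<in> C" using assms unfolding large_def by blast
  obtain n where n: "length t = s + n" using wordsD(1)[OF t(1)] by (metis le_Suc_ex)
  \<comment> \<open>An instance by a word of length \<open>s + n\<close> stops just before the
    parameter \<open>s + n\<close>, hence ends with the tail chosen against its own stem.\<close>
  have fp: "first_pos Y (s + n) = length (M n)"
    by (rule first_pos_eqI) (use YM[of n] YMi[of _ n] Ml[of _ n] in auto)
  have "subst t Y = map ((!) t) (M n)"
    by (rule nth_equalityI) (use YMi[of _ n] in \<open>auto simp: fp n nth_subst\<close>)
  also have "\<dots> = map ((!) t) (L n) @ T (img n (L n))"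
    using map_nth_letters[OF t(1) TL] by (simp add: M_def)
  also have "\<dots> \<notin> C" by (rule T(2)[OF img[OF Lp]]) (use t n in \<open>auto simp: img_def\<close>)
  finally show False using t(2) by contradiction
qed

text \<open>For a fixed tail, colour \<open>z\<close> in the cube by a stem \<open>e\<close> from
  the finite cover that brings \<open>z\<close> and the tail into \<open>C\<close>. On a
  Hales-Jewett line one \<open>e\<close> serves all letters. There are finitely many pairs of stem
  and line, so one pair works for a large set of tails on a subspace, and the variable of the line
  becomes the free letter \<open>c\<close>.\<close>

lemma large_line:
  assumes "0 < s" "large s C"
  shows "\<exists>X \<in> rigids s. large s {\<tau> \<in> words s. \<forall>c<s. subst ([0..<s] @ c # drop s \<tau>) X \<in> C}"
proof -
  obtain E where E: "finite E" "E \<subseteq> words s" and EC: "\<And>t. set t \<subseteq> {..<s} \<Longrightarrow> \<exists>e \<in> E. e @ t \<in> C"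
    using large_cover[OF assms(2)] by blast
  obtain N where N: "\<And>\<chi>. \<chi> ` cube s N \<subseteq> E \<Longrightarrow>
     \<exists>z \<in> var_words s N. \<forall>c<s. \<forall>c'<s. \<chi> (inst s c z) = \<chi> (inst s c' z)"
    using hj_finite[OF hales_jewett[OF assms(1)] E(1)] by blast
  define D where "D p = {\<tau>. \<forall>c<s. fst p @ inst s c (snd p) @ drop s \<tau> \<in> C}" for p
  have "\<exists>p \<in> E \<times> var_words s N. \<tau> \<in> D p" if \<tau>: "\<tau> \<in> words s" for \<tau>
  proof -
    define \<chi> where "\<chi> z = (SOME e. e \<in> E \<and> e @ z @ drop s \<tau> \<in> C)" for z
    have \<chi>: "\<chi> z \<in> E \<and> \<chi> z @ z @ drop s \<tau> \<in> C" if "z \<in> cube s N" for z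
    proof -
      have "set (z @ drop s \<tau>) \<subseteq> {..<s}" using that words_drop[OF \<tau>] by (auto simp: cube_def)
      then have "\<exists>e. e \<in> E \<and> e @ z @ drop s \<tau> \<in> C" using EC by blast
      then show ?thesis unfolding \<chi>_def by (rule someI_ex)
    qed
    then have "\<chi> ` cube s N \<subseteq> E" by blast
    from N[OF this] obtain z where z: "z \<in> var_words s N"
      "\<And>c. c < s \<Longrightarrow> \<chi> (inst s c z) = \<chi> (inst s 0 z)" using assms(1) by blast
    have "\<chi> (inst s 0 z) \<in> E" using \<chi> inst_cube[OF z(1) assms(1)] by blast
    moreover have "\<chi> (inst s 0 z) @ inst s c z @ drop s \<tau> \<in> C" if "c < s" for c
      using \<chi>[OF inst_cube[OF z(1) that]] z(2)[OF that] by simp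
    ultimately show ?thesis using z(1) by (intro bexI[of _ "(\<chi> (inst s 0 z), z)"]) (auto simp: D_def)
  qed
  moreover have "finite (E \<times> var_words s N)" using E(1) finite_var_words by simp
  ultimately obtain X p where X: "X \<in> rigids s" and p: "p \<in> E \<times> var_words s N"
    and lg: "large s {\<tau> \<in> words s. subst \<tau> X \<in> D p}"
    using large_partition[of "E \<times> var_words s N" s D] by blast
  obtain e z where ez: "p = (e, z)" "e \<in> words s" "z \<in> var_words s N" using p E(2) by auto
  have "s \<in> set z" using ez(3) by (simp add: var_words_def)
  then obtain a b where ab: "z = a @ s # b" "s \<notin> set a" by (meson split_list_first)
  have a: "set a \<subseteq> {..<s}" and b: "set b \<subseteq> {..s}" using ez(3) ab by (auto simp: var_words_def le_less)
  have "(e @ a) @ [] @ [s + 0] \<in> param_words s (Suc 0)"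
    by (rule param_words_snoc) (use words_append[OF ez(2) a] in \<open>auto simp: param_words_0\<close>)
  from param_words_append[OF this, of b] have ezp: "e @ z \<in> param_words s 1"
    using b ab(1) by (simp add: atMost_Suc_eq_insert_0 lessThan_Suc_atMost)
  \<comment> \<open>\<open>P\<close> writes \<open>e @ z\<close> with its variable open as parameter
    \<open>s\<close>; \<open>Q\<close> restarts \<open>X\<close> just behind the letter that fills
    it.\<close>
  define P where "P = prepend (e @ z) (s + 1)"
  have P: "P \<in> rigids s" unfolding P_def by (rule prepend_rigids[OF ezp])
  define Q where "Q = shift s (s + 1) id X"
  have Q: "Q \<in> rigids (s + 1)" unfolding Q_def by (rule shift_rigids[OF X]) simp
  have Pc: "subst (([0..<s] @ [c]) @ t) P = e @ inst s c z @ t" if "c < s" for c t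
  proof -
    have "subst (([0..<s] @ [c]) @ t) P = map ((!) ([0..<s] @ [c])) (e @ z) @ t"
      unfolding P_def by (rule subst_prepend) (use ezp in \<open>auto simp: param_words_def\<close>)
    moreover have "map ((!) ([0..<s] @ [c])) e = e"
      using wordsD(2)[OF ez(2)] by (intro map_idI) (auto simp: nth_append)
    moreover have "map ((!) ([0..<s] @ [c])) z = inst s c z"
      using ez(3) unfolding inst_def by (intro map_cong) (auto simp: nth_append var_words_def)
    ultimately show ?thesis by simp
  qed
  have Qc: "subst (([0..<s] @ [c]) @ drop s \<tau>) Q = ([0..<s] @ [c]) @ drop s (subst \<tau> X)"
    if "\<tau> \<in> words s" for c \<tau>
  proof -
    have "subst (([0..<s] @ [c]) @ drop s \<tau>) Q
        = ([0..<s] @ [c]) @ drop s (subst ([0..<s] @ drop s \<tau>) X)"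
      unfolding Q_def by (rule subst_shift[OF X]) (auto simp: nth_append)
    then show ?thesis using wordsD(4)[OF that] by simp
  qed
  have "subst ([0..<s] @ c # drop s \<tau>) (Q \<circ> P) \<in> C"
    if "\<tau> \<in> words s" "subst \<tau> X \<in> D p" "c < s" for \<tau> c
  proof -
    have "subst ([0..<s] @ c # drop s \<tau>) (Q \<circ> P) = e @ inst s c z @ drop s (subst \<tau> X)"
      using Pc[OF that(3)] Qc[OF that(1), of c]
      by (simp add: subst_comp[OF rigids_rigid[OF Q] rigids_rigid[OF P]])
    then show ?thesis using that(2,3) by (simp add: D_def ez(1))
  qed
  then have "large s {\<tau> \<in> words s. \<forall>c<s. subst ([0..<s] @ c # drop s \<tau>) (Q \<circ> P) \<in> C}"
    by (intro large_mono[OF lg]) auto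
  moreover have "Q \<circ> P \<in> rigids s" using rigids_antimono[OF Q] P by (simp add: rigids_comp)
  ultimately show ?thesis by blast
qed

text \<open>The tails that suit all stems with \<open>n\<close> letters behind the prefix
  \<open>[0..<s]\<close> simultaneously; largeness of this set is the invariant of both fusions
  below.\<close>

definition common_tails :: "nat \<Rightarrow> nat \<Rightarrow> nat list set \<Rightarrow> (nat \<Rightarrow> nat) \<Rightarrow> nat list set" where
  "common_tails s n C W =
     {\<tau> \<in> words s. \<forall>u \<in> words s. length u = s + n \<longrightarrow> subst (u @ drop s \<tau>) W \<in> C}"

lemma common_tails_0: "large s C \<Longrightarrow> large s (common_tails s 0 C id)"
proof (rule large_mono, assumption)
  fix t assume t: "t \<in> words s" "t \<in> C"
  have "u @ drop s t = t" if "u \<in> words s" "length u = s" for u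
    using wordsD(4)[OF that(1)] wordsD(4)[OF t(1)] that(2) by simp
  then show "t \<in> common_tails s 0 C id" using t by (auto simp: common_tails_def)
qed

text \<open>Moved behind the stems of length \<open>s + n\<close>, the free letter of
  \<open>X\<close> becomes the last letter of a stem of length \<open>s + Suc n\<close>. The last
  conclusion tells what a stem with nothing behind it turns into, which later brings the words of
  this length into \<open>C\<close>.\<close>

lemma common_tails_step:
  assumes W: "W \<in> rigids s" and X: "X \<in> rigids s"
    and lg: "large s {\<tau> \<in> words s. \<forall>c<s. subst ([0..<s] @ c # drop s \<tau>) X \<in> common_tails s n C W}"
  obtains X' where "X' \<in> rigids (s + n)" "large s (common_tails s (Suc n) C (X' \<circ> W))"
    "\<And>u. u \<in> words s \<Longrightarrow> length u = s + n \<Longrightarrow>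
       subst u (X' \<circ> W) = subst (u @ drop s (subst [0..<s] X)) W"
proof -
  define X' where "X' = shift s (s + n) id X"
  have X': "X' \<in> rigids (s + n)" unfolding X'_def by (rule shift_rigids[OF X]) simp
  have sub: "subst (u @ t) (X' \<circ> W) = subst (u @ drop s (subst ([0..<s] @ t) X)) W"
    if "u \<in> words s" "length u = s + n" for u t
  proof -
    have "subst (u @ t) X' = u @ drop s (subst ([0..<s] @ t) X)"
      unfolding X'_def by (rule subst_shift[OF X]) (use that wordsD(3)[OF that(1)] in auto)
    then show ?thesis by (simp add: subst_comp[OF rigids_rigid[OF X'] rigids_rigid[OF W]])
  qed
  have "subst (v @ drop s \<tau>) (X' \<circ> W) \<in> C"
    if \<tau>: "\<tau> \<in> words s" "\<And>c. c < s \<Longrightarrow> subst ([0..<s] @ c # drop s \<tau>) X \<in> common_tails s n C W"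
      and v: "v \<in> words s" "length v = s + Suc n" for \<tau> v
  proof -
    obtain u c where uc: "v = u @ [c]" using v(2) by (cases v rule: rev_cases) auto
    have u: "length u = s + n" and c: "c < s" using v wordsD(2)[OF v(1)] uc by auto
    have uw: "u \<in> words s"
    proof (rule wordsI)
      show "u ! j = j" if "j < s" for j using wordsD(3)[OF v(1) that] that u by (simp add: uc nth_append)
    qed (use u wordsD(2)[OF v(1)] uc in auto)
    have "subst (v @ drop s \<tau>) (X' \<circ> W) = subst (u @ drop s (subst ([0..<s] @ c # drop s \<tau>) X)) W"
      using sub[OF uw u, of "c # drop s \<tau>"] by (simp add: uc)
    then show ?thesis using \<tau>(2)[OF c] uw u by (simp add: common_tails_def)
  qed
  then have "large s (common_tails s (Suc n) C (X' \<circ> W))"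
    by (intro large_mono[OF lg]) (auto simp: common_tails_def)
  then show ?thesis using sub[of _ "[]"] by (intro that[OF X']) auto
qed

text \<open>Iterating \<open>large_line\<close> produces a parameter word; by largeness some instance of it lies in
  \<open>C\<close>, and the iteration is cut off there.\<close>

lemma large_line_base:
  assumes "0 < s" "large s C"
  shows "\<exists>X \<in> rigids s. subst [0..<s] X \<in> C \<and>
    large s {\<tau> \<in> words s. \<forall>c<s. subst ([0..<s] @ c # drop s \<tau>) X \<in> C}"
proof -
  obtain W where W: "W \<in> rigids s"
    and WV: "\<And>n. \<exists>V \<in> rigids s. \<exists>Z \<in> rigids (s + n). large s (common_tails s n C V) \<and> W = Z \<circ> V"
  proof (rule fusion[of "\<lambda>n V. large s (common_tails s n C V)" s])
    show "large s (common_tails s 0 C id)" using assms(2) by (rule common_tails_0)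
  next
    fix n W assume W: "W \<in> rigids s" "large s (common_tails s n C W)"
    obtain X where "X \<in> rigids s"
      "large s {\<tau> \<in> words s. \<forall>c<s. subst ([0..<s] @ c # drop s \<tau>) X \<in> common_tails s n C W}"
      using large_line[OF assms(1) W(2)] by blast
    from common_tails_step[OF W(1) this]
    show "\<exists>X \<in> rigids (s + n). large s (common_tails s (Suc n) C (X \<circ> W))" by metis
  qed blast
  obtain u where u: "u \<in> words s" "subst u W \<in> C" using assms(2) W unfolding large_def by blast
  obtain n where n: "length u = s + n" using wordsD(1)[OF u(1)] by (metis le_Suc_ex)
  \<comment> \<open>One stage beyond the length of \<open>u\<close>: \<open>Z\<close> then fixes
    \<open>u\<close> together with its end, and the stems reach one letter past
    \<open>u\<close>.\<close>
  obtain V Z where V: "V \<in> rigids s" and Z: "Z \<in> rigids (s + Suc n)"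
    and lg: "large s (common_tails s (Suc n) C V)" and WZ: "W = Z \<circ> V" using WV[of "Suc n"] by blast
  have uV: "subst u V \<in> C"
    using u(2) subst_fixed[OF Z, of u] n
    by (simp add: WZ subst_comp[OF rigids_rigid[OF Z] rigids_rigid[OF V]])
  have up: "u \<in> param_words s 0" using u(1) by (simp add: param_words_0)
  define P where "P = prepend u (s + 0)"
  have P: "P \<in> rigids s" unfolding P_def by (rule prepend_rigids[OF up])
  have Pt: "subst ([0..<s] @ t) P = u @ t" for t
  proof -
    have "subst ([0..<s] @ t) P = map ((!) [0..<s]) u @ t"
      unfolding P_def by (rule subst_prepend) (use up in \<open>auto simp: param_words_def\<close>)
    then show ?thesis using map_nth_letters[OF words_upt wordsD(2)[OF u(1)]] by simp
  qed
  have PV: "subst ([0..<s] @ t) (P \<circ> V) = subst (u @ t) V" for t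
    by (simp add: Pt subst_comp[OF rigids_rigid[OF P] rigids_rigid[OF V]])
  have "large s {\<tau> \<in> words s. \<forall>c<s. subst ([0..<s] @ c # drop s \<tau>) (P \<circ> V) \<in> C}"
  proof (rule large_mono[OF lg])
    fix \<tau> assume \<tau>: "\<tau> \<in> words s" "\<tau> \<in> common_tails s (Suc n) C V"
    have "subst ([0..<s] @ c # drop s \<tau>) (P \<circ> V) \<in> C" if "c < s" for c
    proof -
      have "u @ [c] \<in> words s" using words_append[OF u(1), of "[c]"] that by simp
      moreover have "length (u @ [c]) = s + Suc n" using n by simp
      ultimately have "subst ((u @ [c]) @ drop s \<tau>) V \<in> C"
        using \<tau>(2) unfolding common_tails_def by blast
      then show ?thesis by (simp add: PV)
    qed
    then show "\<tau> \<in> {\<tau> \<in> words s. \<forall>c<s. subst ([0..<s] @ c # drop s \<tau>) (P \<circ> V) \<in> C}" using \<tau>(1) by blast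
  qed
  moreover have "subst [0..<s] (P \<circ> V) \<in> C" using PV[of "[]"] uV by simp
  ultimately show ?thesis using rigids_comp[OF P V] by blast
qed

text \<open>Each stage settles a single length, and fusion preserves it. Applying
  \<open>large_line_base\<close> to the common tails instead of \<open>C\<close> makes its base word
  settle length \<open>s + n\<close>, while its large set keeps the construction going. At stage 0
  there is nothing to settle, as all words have length at least \<open>s\<close>.\<close>

lemma large_contains_subspace:
  assumes "0 < s" "large s C"
  shows "\<exists>W \<in> rigids s. \<forall>u \<in> words s. subst u W \<in> C"
proof -
  define Inv where "Inv n V \<longleftrightarrow> large s (common_tails s n C V) \<and>
      (\<forall>u \<in> words s. Suc (length u) = s + n \<longrightarrow> subst u V \<in> C)" for n V
  obtain W where W: "W \<in> rigids s"
    and WV: "\<And>n. \<exists>V \<in> rigids s. \<exists>Z \<in> rigids (s + n). Inv n V \<and> W = Z \<circ> V"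
  proof (rule fusion[of Inv s])
    show "Inv 0 id" unfolding Inv_def using common_tails_0[OF assms(2)] wordsD(1) by fastforce
  next
    fix n W assume W: "W \<in> rigids s" "Inv n W"
    obtain X where X: "X \<in> rigids s" and X0: "subst [0..<s] X \<in> common_tails s n C W"
      and lg: "large s {\<tau> \<in> words s. \<forall>c<s. subst ([0..<s] @ c # drop s \<tau>) X \<in> common_tails s n C W}"
      using large_line_base[OF assms(1)] W(2) unfolding Inv_def by blast
    obtain X' where X': "X' \<in> rigids (s + n)" "large s (common_tails s (Suc n) C (X' \<circ> W))"
      "\<And>u. u \<in> words s \<Longrightarrow> length u = s + n \<Longrightarrow>
       subst u (X' \<circ> W) = subst (u @ drop s (subst [0..<s] X)) W"
      using common_tails_step[OF W(1) X lg] by metis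
    have "Inv (Suc n) (X' \<circ> W)"
      unfolding Inv_def using X'(2,3) X0 by (auto simp: common_tails_def)
    then show "\<exists>X \<in> rigids (s + n). Inv (Suc n) (X \<circ> W)" using X'(1) by blast
  qed blast
  have "subst u W \<in> C" if u: "u \<in> words s" for u
  proof -
    obtain n where n: "length u = s + n" using wordsD(1)[OF u] by (metis le_Suc_ex)
    obtain V Z where V: "V \<in> rigids s" and Z: "Z \<in> rigids (s + Suc n)"
      and Inv: "Inv (Suc n) V" and WZ: "W = Z \<circ> V" using WV[of "Suc n"] by blast
    have "subst u V \<in> C" using Inv u n unfolding Inv_def by simp
    then show ?thesis
      using subst_fixed[OF Z, of u] n
      by (simp add: WZ subst_comp[OF rigids_rigid[OF Z] rigids_rigid[OF V]])
  qed
  then show ?thesis using W by blast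
qed

definition ramsey :: "nat \<Rightarrow> nat \<Rightarrow> bool" where
  "ramsey s k \<longleftrightarrow> (\<forall>\<chi> :: nat list \<Rightarrow> nat. finite (\<chi> ` param_words s k) \<longrightarrow>
     (\<exists>W \<in> rigids s. \<exists>d. \<forall>U \<in> param_words s k. \<chi> (subst U W) = d))"

text \<open>The colour classes partition the words, so one class is large on a subspace and there
  contains a further subspace. Over the empty alphabet \<open>[]\<close> is the only word.\<close>

theorem carlson_simpson: "ramsey s 0"
proof (cases "s = 0")
  case True
  then have "param_words s 0 = {[]}" by (simp add: param_words_0 words_def)
  then show ?thesis unfolding ramsey_def by (intro allI impI bexI[of _ id]) auto
next
  case False
  show ?thesis unfolding ramsey_def param_words_0
  proof (intro allI impI)
    fix \<chi> :: "nat list \<Rightarrow> nat" assume fin: "finite (\<chi> ` words s)"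
    obtain X d where X: "X \<in> rigids s" and lg: "large s {t \<in> words s. subst t X \<in> {t. \<chi> t = d}}"
      using large_partition[OF fin, of s "\<lambda>d. {t. \<chi> t = d}"] by auto
    obtain W where W: "W \<in> rigids s" "\<And>u. u \<in> words s \<Longrightarrow> \<chi> (subst (subst u W) X) = d"
      using large_contains_subspace[OF _ lg] False by auto
    then have "\<forall>U \<in> words s. \<chi> (subst U (W \<circ> X)) = d"
      by (simp add: subst_comp[OF rigids_rigid[OF W(1)] rigids_rigid[OF X]])
    then show "\<exists>W \<in> rigids s. \<exists>d. \<forall>U \<in> words s. \<chi> (subst U W) = d"
      using rigids_comp[OF W(1) X] by blast
  qed
qed

section \<open>Adding parameters\<close>

text \<open>Fusion and the envelopes below use lists and functions as colours.\<close>

lemma ramsey_finite: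
  fixes \<chi> :: "nat list \<Rightarrow> 'c"
  assumes "ramsey s k" "finite (\<chi> ` param_words s k)"
  shows "\<exists>W \<in> rigids s. \<exists>d. \<forall>U \<in> param_words s k. \<chi> (subst U W) = d"
proof -
  define K where "K = \<chi> ` param_words s k"
  have inj: "inj_on (to_nat_on K) K"
    using assms(2) unfolding K_def by (intro inj_on_to_nat_on countable_finite)
  have "finite ((\<lambda>U. to_nat_on K (\<chi> U)) ` param_words s k)"
    using finite_imageI[OF assms(2), of "to_nat_on K"] by (simp add: image_image)
  then obtain W d where W: "W \<in> rigids s"
    and d: "\<And>U. U \<in> param_words s k \<Longrightarrow> to_nat_on K (\<chi> (subst U W)) = d"
    using assms(1) unfolding ramsey_def by metis
  have "\<chi> (subst U W) = from_nat_into K d" if "U \<in> param_words s k" for U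
  proof -
    have "\<chi> (subst U W) \<in> K" using param_words_subst[OF that W] by (simp add: K_def)
    moreover have "countable K" using assms(2) by (simp add: K_def countable_finite)
    ultimately show ?thesis using d[OF that] by (metis from_nat_into_to_nat_on)
  qed
  then show ?thesis using W by blast
qed

text \<open>The right-hand side does not mention \<open>u\<close>: a tail fits behind every stem or
  behind none. So the stem can be exchanged for \<open>[0..<s]\<close>, where the parameter
  \<open>s\<close> may be read as a letter.\<close>

lemma param_words_Cons_iff:
  assumes u: "u \<in> words s"
  shows "u @ s # V \<in> param_words s (Suc k) \<longleftrightarrow> set V \<subseteq> {..<s + Suc k} \<and>
    (\<forall>m. s < m \<and> m < s + Suc k \<longrightarrow> (\<exists>j<length V. V ! j = m \<and> (\<forall>i<j. V ! i < m)))"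
    (is "?U \<in> _ \<longleftrightarrow> ?S \<and> ?G")
proof -
  have ui: "u ! i < s" if "i < length u" for i using that wordsD(2)[OF u] nth_mem by blast
  have U1: "?U ! i = u ! i" if "i < length u" for i using that by (simp add: nth_append)
  have U2: "?U ! length u = s" by simp
  have U3: "?U ! (length u + Suc i) = V ! i" for i by (simp add: nth_append)
  have split: "i < length u \<or> i = length u \<or> (\<exists>i'. i = length u + Suc i')" for i
    by (metis add_Suc_right less_imp_Suc_add linorder_neqE_nat)
  have set: "set ?U \<subseteq> {..<s + Suc k} \<longleftrightarrow> ?S" using wordsD(2)[OF u] by auto
  have small: "\<exists>j<length ?U. ?U ! j = m \<and> (\<forall>i<j. ?U ! i < m)" if "m \<le> s" for m
  proof (cases "m = s")
    case True
    then show ?thesis using U1 U2 ui by (intro exI[of _ "length u"]) auto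
  next
    case False
    then have "m < s" using that by simp
    then show ?thesis using wordsD(1,3)[OF u] by (intro exI[of _ m]) (auto simp: nth_append)
  qed
  have big: "(\<exists>j<length ?U. ?U ! j = m \<and> (\<forall>i<j. ?U ! i < m)) \<longleftrightarrow>
      (\<exists>j<length V. V ! j = m \<and> (\<forall>i<j. V ! i < m))" if m: "s < m" for m
  proof
    assume "\<exists>j<length ?U. ?U ! j = m \<and> (\<forall>i<j. ?U ! i < m)"
    then obtain j where j: "j < length ?U" "?U ! j = m" "\<And>i. i < j \<Longrightarrow> ?U ! i < m" by blast
    then obtain j' where j': "j = length u + Suc j'"
      using split[of j] U1[of j] U2 ui[of j] m by auto
    have "V ! i < m" if "i < j'" for i using j(3)[of "length u + Suc i"] that U3[of i] j' by simp
    then show "\<exists>j<length V. V ! j = m \<and> (\<forall>i<j. V ! i < m)"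
      using j(1,2) j' U3[of j'] by (intro exI[of _ j']) auto
  next
    assume "\<exists>j<length V. V ! j = m \<and> (\<forall>i<j. V ! i < m)"
    then obtain j where j: "j < length V" "V ! j = m" "\<And>i. i < j \<Longrightarrow> V ! i < m" by blast
    have "?U ! i < m" if "i < length u + Suc j" for i
      using split[of i]
    proof (elim disjE exE)
      assume "i < length u"
      then show ?thesis using U1[of i] ui[of i] m by simp
    next
      assume "i = length u"
      then show ?thesis using U2 m by simp
    next
      fix i' assume "i = length u + Suc i'"
      then show ?thesis using U3[of i'] j(3)[of i'] that by simp
    qed
    then show "\<exists>j<length ?U. ?U ! j = m \<and> (\<forall>i<j. ?U ! i < m)"
      using j(1,2) U3[of j] by (intro exI[of _ "length u + Suc j"]) auto
  qed
  have grow: "(\<forall>m<s + Suc k. \<exists>j<length ?U. ?U ! j = m \<and> (\<forall>i<j. ?U ! i < m)) \<longleftrightarrow> ?G"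
  proof (intro iffI allI impI)
    fix m assume "\<forall>m<s + Suc k. \<exists>j<length ?U. ?U ! j = m \<and> (\<forall>i<j. ?U ! i < m)" "s < m \<and> m < s + Suc k"
    then show "\<exists>j<length V. V ! j = m \<and> (\<forall>i<j. V ! i < m)" using big[of m] by blast
  next
    fix m assume "?G" "m < s + Suc k"
    then show "\<exists>j<length ?U. ?U ! j = m \<and> (\<forall>i<j. ?U ! i < m)"
      using small[of m] big[of m] by (cases "m \<le> s") auto
  qed
  have "s \<le> length ?U" "\<forall>j<s. ?U ! j = j"
    using wordsD(1,3)[OF u] by (auto simp: nth_append)
  then show ?thesis unfolding param_words_def restricted_growth_def mem_Collect_eq set grow by blast
qed

lemma param_words_Suc_alphabet:
  "[0..<s] @ s # V \<in> param_words s (Suc k) \<longleftrightarrow> [0..<s] @ s # V \<in> param_words (Suc s) k"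
  by (auto simp: param_words_def nth_append less_Suc_eq)

lemma param_words_split:
  assumes "U \<in> param_words s (Suc k)"
  obtains u V where "U = u @ s # V" "u \<in> words s"
proof -
  have U: "s \<le> length U" "\<And>j. j < s \<Longrightarrow> U ! j = j" using assms by (auto simp: param_words_def)
  have "\<exists>j<length U. U ! j = s \<and> (\<forall>i<j. U ! i < s)"
    using assms by (simp add: param_words_def restricted_growth_def)
  then obtain j where j: "j < length U" "U ! j = s" "\<And>i. i < j \<Longrightarrow> U ! i < s" by blast
  have sj: "s \<le> j" using U(2)[of j] j(2) by (metis less_irrefl not_le)
  have "U = take j U @ s # drop (Suc j) U" using j(1,2) by (metis id_take_nth_drop)
  moreover have "take j U \<in> words s"
  proof (rule wordsI)
    show "set (take j U) \<subseteq> {..<s}" using j by (auto simp: in_set_conv_nth)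
  qed (use U sj j(1) in auto)
  ultimately show ?thesis using that by blast
qed

lemma subst_append_Cons:
  assumes "rigid W"
  obtains V' where "subst (u @ x # V) W = subst u W @ x # V'"
proof -
  let ?U = "u @ x # V"
  let ?p = "first_pos W (length u)"
  have p: "?p < first_pos W (length ?U)" by (rule first_pos_less[OF assms]) simp
  have "take ?p (subst ?U W) = subst u W"
    using p first_pos(2)[OF assms, of _ "length u"]
    by (intro nth_equalityI) (auto simp: nth_subst nth_append)
  moreover have "subst ?U W ! ?p = x" using p first_pos(1)[OF assms] by (simp add: nth_subst)
  moreover have "subst ?U W = take ?p (subst ?U W) @ subst ?U W ! ?p # drop (Suc ?p) (subst ?U W)"
    by (rule id_take_nth_drop) (use p in simp)
  ultimately show ?thesis using that by metis
qed

text \<open>A word with \<open>k + 1\<close> parameters is a word \<open>u\<close> over the alphabet, the first parameter, and a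
  word with \<open>k\<close> parameters in which the first one counts as a letter.  Fusion makes the colour
  depend on \<open>u\<close> only.\<close>

lemma ramsey_Suc:
  assumes R: "ramsey (Suc s) k"
  shows "ramsey s (Suc k)"
  unfolding ramsey_def
proof (intro allI impI)
  fix \<chi> :: "nat list \<Rightarrow> nat" assume fin: "finite (\<chi> ` param_words s (Suc k))"
  let ?P = "param_words s (Suc k)"
  define Inv where "Inv n W \<longleftrightarrow> (\<forall>u \<in> words s. Suc (length u) = s + n \<longrightarrow>
    (\<forall>V V'. u @ s # V \<in> ?P \<longrightarrow> u @ s # V' \<in> ?P \<longrightarrow>
       \<chi> (subst (u @ s # V) W) = \<chi> (subst (u @ s # V') W)))" for n W
  obtain W where W: "W \<in> rigids s"
    and WV: "\<And>n. \<exists>V \<in> rigids s. \<exists>Z \<in> rigids (s + n). Inv n V \<and> W = Z \<circ> V"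
  proof (rule fusion[of Inv s])
    show "Inv 0 id" unfolding Inv_def using wordsD(1) by fastforce
  next
    fix n W assume W: "W \<in> rigids s"
    obtain us where us: "set us = {u \<in> words s. length u = s + n}"
      using finite_list[OF finite_words_length] by blast
    \<comment> \<open>A single colour collects the colours behind all stems of length
      \<open>s + n\<close>.\<close>
    define \<psi> where "\<psi> Vh = map (\<lambda>u. \<chi> (subst (u @ drop s Vh) W)) us" for Vh
    have split: "\<exists>V. Vh = [0..<s] @ s # V" if "Vh \<in> param_words (Suc s) k" for Vh
    proof -
      have "Suc s \<le> length Vh" "\<And>j. j < Suc s \<Longrightarrow> Vh ! j = j" using that by (auto simp: param_words_def)
      then have "take s Vh = [0..<s]" "Vh ! s = s" "s < length Vh"
        by (auto intro: nth_equalityI)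
      then show ?thesis using id_take_nth_drop[of s Vh] by metis
    qed
    have mem: "u @ drop s Vh \<in> ?P" if u: "u \<in> words s" and Vh: "Vh \<in> param_words (Suc s) k" for u Vh
    proof -
      obtain V where V: "Vh = [0..<s] @ s # V" using split[OF Vh] by blast
      then show ?thesis
        using u Vh param_words_Suc_alphabet[of s V k] param_words_Cons_iff[OF words_upt, of s V k]
          param_words_Cons_iff[OF u, of V k] by simp
    qed
    have "\<psi> ` param_words (Suc s) k \<subseteq> {l. set l \<subseteq> \<chi> ` ?P \<and> length l = length us}"
      using mem us param_words_subst[OF _ W] by (auto simp: \<psi>_def)
    then have "finite (\<psi> ` param_words (Suc s) k)"
      using finite_lists_length_eq[OF fin] finite_subset by blast
    then obtain Y d where Y: "Y \<in> rigids (Suc s)"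
      and Yd: "\<And>Vh. Vh \<in> param_words (Suc s) k \<Longrightarrow> \<psi> (subst Vh Y) = d"
      using ramsey_finite[OF R] by blast
    \<comment> \<open>\<open>Y\<close> reads the extra letter at position \<open>s\<close>; behind a
      stem of length \<open>s + n\<close> it stands at position \<open>s + n\<close>, which has to
      stay fixed too.\<close>
    define \<sigma> where "\<sigma> c = (if c < s then c else s + n)" for c
    define X where "X = shift (Suc s) (s + n + 1) \<sigma> Y"
    have X: "X \<in> rigids (s + n + 1)" unfolding X_def
      by (rule shift_rigids[OF Y]) (auto simp: \<sigma>_def)
    have sub: "subst (u @ s # V) (X \<circ> W) = subst (u @ drop s (subst ([0..<s] @ s # V) Y)) W"
      if u: "u \<in> words s" "length u = s + n" for u V
    proof -
      have "length ([0..<s] @ [s]) = Suc s" by simp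
      then obtain t where t: "subst (([0..<s] @ [s]) @ V) Y = ([0..<s] @ [s]) @ t"
        using subst_prefix[of Y "[0..<s] @ [s]" V] Y by metis
      have "subst ((u @ [s]) @ V) X = (u @ [s]) @ drop (Suc s) (subst (([0..<s] @ [s]) @ V) Y)"
        unfolding X_def
        by (rule subst_shift[OF Y])
          (use u wordsD(3)[OF u(1)] in \<open>auto simp: \<sigma>_def nth_append less_Suc_eq\<close>)
      then show ?thesis using t by (simp add: subst_comp[OF rigids_rigid[OF X] rigids_rigid[OF W]])
    qed
    have "Inv (Suc n) (X \<circ> W)" unfolding Inv_def
    proof (intro ballI impI allI)
      fix u V V'
      assume u: "u \<in> words s" "Suc (length u) = s + Suc n" and V: "u @ s # V \<in> ?P" "u @ s # V' \<in> ?P"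
      have "[0..<s] @ s # V \<in> param_words (Suc s) k" "[0..<s] @ s # V' \<in> param_words (Suc s) k"
        using V unfolding param_words_Suc_alphabet[symmetric] param_words_Cons_iff[OF u(1)]
          param_words_Cons_iff[OF words_upt] by blast+
      then have "\<psi> (subst ([0..<s] @ s # V) Y) = \<psi> (subst ([0..<s] @ s # V') Y)" using Yd by metis
      then show "\<chi> (subst (u @ s # V) (X \<circ> W)) = \<chi> (subst (u @ s # V') (X \<circ> W))"
        using sub[of u] u us by (simp add: \<psi>_def)
    qed
    then show "\<exists>X \<in> rigids (s + n). Inv (Suc n) (X \<circ> W)"
      using rigids_antimono[OF X, of "s + n"] by auto
  qed blast
  have dep: "\<chi> (subst (u @ s # V) W) = \<chi> (subst (u @ s # V') W)"
    if u: "u \<in> words s" and V: "u @ s # V \<in> ?P" "u @ s # V' \<in> ?P" for u V V'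
  proof -
    obtain n where n: "length u = s + n" using wordsD(1)[OF u] by (metis le_Suc_ex)
    obtain T Z where T: "T \<in> rigids s" and Z: "Z \<in> rigids (s + Suc n)"
      and Inv: "Inv (Suc n) T" and WZ: "W = Z \<circ> T" using WV[of "Suc n"] by blast
    \<comment> \<open>\<open>Z\<close> fixes the stem and the parameter following it, so only the
      tail changes, and at stage \<open>Suc n\<close> the colour does not depend on the
      tail.\<close>
    have red: "\<exists>V'. u @ s # V' \<in> ?P \<and> subst (u @ s # V) W = subst (u @ s # V') T"
      if "u @ s # V \<in> ?P" for V
    proof -
      have "Z \<in> rigids (length (u @ [s]))" using Z n by simp
      then obtain V' where V': "subst ((u @ [s]) @ V) Z = (u @ [s]) @ V'" by (rule subst_prefix)
      moreover have "subst (u @ s # V) Z \<in> ?P"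
        using that rigids_antimono[OF Z] by (intro param_words_subst) auto
      ultimately show ?thesis
        by (intro exI[of _ V']) (simp add: WZ subst_comp[OF rigids_rigid[OF Z] rigids_rigid[OF T]])
    qed
    obtain V1 where V1: "u @ s # V1 \<in> ?P" "subst (u @ s # V) W = subst (u @ s # V1) T"
      using red[OF V(1)] by blast
    obtain V2 where V2: "u @ s # V2 \<in> ?P" "subst (u @ s # V') W = subst (u @ s # V2) T"
      using red[OF V(2)] by blast
    have "Suc (length u) = s + Suc n" using n by simp
    then have "\<chi> (subst (u @ s # V1) T) = \<chi> (subst (u @ s # V2) T)"
      using Inv u V1(1) V2(1) unfolding Inv_def by blast
    then show ?thesis using V1(2) V2(2) by simp
  qed
  \<comment> \<open>Any fixed tail would do; the remaining parameters in order fit behind every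
    stem.\<close>
  define V0 where "V0 = [Suc s..<s + Suc k]"
  have V0: "u @ s # V0 \<in> ?P" if "u \<in> words s" for u
  proof -
    have "\<exists>j<length V0. V0 ! j = m \<and> (\<forall>i<j. V0 ! i < m)" if "s < m" "m < s + Suc k" for m
      using that by (intro exI[of _ "m - Suc s"]) (auto simp: V0_def simp del: upt_Suc)
    then show ?thesis unfolding param_words_Cons_iff[OF that] by (auto simp: V0_def)
  qed
  define \<chi>' where "\<chi>' u = \<chi> (subst (u @ s # V0) W)" for u
  have "\<chi>' ` words s \<subseteq> \<chi> ` ?P" using V0 param_words_subst[OF _ W] by (auto simp: \<chi>'_def)
  then have "finite (\<chi>' ` param_words s 0)" using fin finite_subset unfolding param_words_0 by blast
  then obtain W' d where W': "W' \<in> rigids s" and d: "\<And>u. u \<in> words s \<Longrightarrow> \<chi>' (subst u W') = d"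
    using carlson_simpson[of s] unfolding ramsey_def param_words_0 by metis
  have "\<chi> (subst U (W' \<circ> W)) = d" if U: "U \<in> ?P" for U
  proof -
    obtain u V where uV: "U = u @ s # V" "u \<in> words s" using param_words_split[OF U] .
    obtain V' where V': "subst U W' = subst u W' @ s # V'"
      using subst_append_Cons[OF rigids_rigid[OF W']] uV(1) by metis
    have u': "subst u W' \<in> words s" using words_subst[OF uV(2) W'] .
    have "subst u W' @ s # V' \<in> ?P" using param_words_subst[OF U W'] V' by simp
    from dep[OF u' this V0[OF u']] show ?thesis
      using d[OF uV(2)] V' by (simp add: \<chi>'_def subst_comp[OF rigids_rigid[OF W'] rigids_rigid[OF W]])
  qed
  then show "\<exists>W \<in> rigids s. \<exists>d. \<forall>U \<in> ?P. \<chi> (subst U W) = d" using rigids_comp[OF W' W] by blast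
qed

theorem ramsey_param_words: "ramsey s k"
  by (induction k arbitrary: s) (simp_all add: carlson_simpson ramsey_Suc)

section \<open>The graph of 0-1 words\<close>

text \<open>Finite counterpart of \<open>subst\<close>: \<open>V\<close> may be shorter than the
  number of parameters, and the cut comes at the first parameter without a value.\<close>

definition list_subst :: "'c list \<Rightarrow> nat list \<Rightarrow> 'c list" where
  "list_subst V E = map ((!) V) (takeWhile (\<lambda>x. x < length V) E)"

text \<open>Associativity of substitution: refining an envelope by \<open>W\<close> moves the words
  inside it by \<open>W\<close>.\<close>

lemma list_subst_subst:
  assumes W: "rigid W"
  shows "list_subst V (subst E W) = subst (list_subst V E) W"
proof -
  let ?P = "\<lambda>x. x < length V"
  let ?K = "takeWhile ?P E"
  let ?p = "first_pos W (length ?K)"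
  have K: "length ?K \<le> length E" by (rule length_takeWhile_le)
  have pE: "?p \<le> first_pos W (length E)" using first_pos_mono[OF W K] .
  have WK: "W i < length ?K" if "i < ?p" for i using first_pos(2)[OF W that] .
  have KE: "?K ! i = E ! i" if "i < length ?K" for i using takeWhile_nth[OF that] .
  have "takeWhile ?P (subst E W) = take ?p (subst E W)"
  proof (rule takeWhile_eq_take_P_nth)
    fix i assume "i < ?p" "i < length (subst E W)"
    then show "subst E W ! i < length V"
      using WK[of i] KE[of "W i"] nth_mem[OF WK[of i]] by (auto simp: nth_subst dest: set_takeWhileD)
  next
    assume "?p < length (subst E W)"
    then have p: "?p < first_pos W (length E)" by simp
    have "length ?K < length E"
    proof (rule ccontr)
      assume "\<not> ?thesis"
      with K have "length ?K = length E" by simp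
      with p show False by simp
    qed
    then have "\<not> E ! length ?K < length V" by (rule nth_length_takeWhile)
    then show "\<not> subst E W ! ?p < length V" using p first_pos(1)[OF W] by (simp add: nth_subst)
  qed
  then have "list_subst V (subst E W) = map ((!) V) (take ?p (subst E W))" by (simp add: list_subst_def)
  also have "\<dots> = subst (list_subst V E) W"
    using pE WK KE by (intro nth_equalityI) (auto simp: list_subst_def nth_subst)
  finally show ?thesis .
qed

text \<open>The second clause of \<open>adj\<close> excludes triangles: the last two vertices of one would have a
  common earlier neighbour.\<close>

definition adj :: "bool list \<Rightarrow> bool list \<Rightarrow> bool" where
  "adj U V \<longleftrightarrow> length U < length V \<and> V ! length U \<and> \<not> (\<exists>j<length U. U ! j \<and> V ! j)"

definition word_graph :: "bool list sgraph" where
  "word_graph = \<lparr>verts = UNIV, edges = {(U, V). adj U V \<or> adj V U}\<rparr>"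

lemma word_graph_simps [simp]:
  "verts word_graph = UNIV" "(U, V) \<in> edges word_graph \<longleftrightarrow> adj U V \<or> adj V U"
  by (simp_all add: word_graph_def)

lemma is_graph_word_graph: "is_graph word_graph"
  by (auto simp: is_graph_def sym_def irrefl_def adj_def)

lemma adj_no_triangle: "adj U V \<Longrightarrow> adj V W \<Longrightarrow> \<not> adj U W"
  by (auto simp: adj_def)

lemma triangle_free_word_graph: "triangle_free word_graph"
  unfolding triangle_free_def word_graph_simps
proof (rule notI, elim exE conjE)
  fix u v w
  assume a: "adj u v \<or> adj v u" "adj v w \<or> adj w v" "adj u w \<or> adj w u"
  have asym: "\<not> (adj U V \<and> adj V U)" for U V by (auto simp: adj_def)
  have trans: "\<not> (adj U V \<and> adj V W \<and> adj W U)" for U V W by (auto simp: adj_def)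
  show False using a asym trans adj_no_triangle by metis
qed

text \<open>A common 1 at \<open>j\<close> after substitution comes from one at \<open>W j\<close>,
  and a common 1 at \<open>j\<close> before it reappears at \<open>first_pos W j\<close>. The end of
  \<open>U\<close> moves to the first occurrence of the parameter whose value is tested.\<close>

lemma adj_subst:
  assumes W: "rigid W"
  shows "adj (subst U W) (subst V W) \<longleftrightarrow> adj U V"
proof (cases "length U < length V")
  case False
  then have "\<not> first_pos W (length U) < first_pos W (length V)"
    using first_pos_mono[OF W, of "length V" "length U"] by simp
  then show ?thesis using False by (simp add: adj_def)
next
  case True
  have l: "first_pos W (length U) < first_pos W (length V)" using first_pos_less[OF W True] .
  have "(\<exists>j<first_pos W (length U). subst U W ! j \<and> subst V W ! j) \<longleftrightarrow> (\<exists>j<length U. U ! j \<and> V ! j)"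
  proof
    assume "\<exists>j<first_pos W (length U). subst U W ! j \<and> subst V W ! j"
    then obtain j where "j < first_pos W (length U)" "U ! W j" "V ! W j"
      using l by (auto simp: nth_subst)
    then show "\<exists>j<length U. U ! j \<and> V ! j" using first_pos(2)[OF W] by blast
  next
    assume "\<exists>j<length U. U ! j \<and> V ! j"
    then obtain j where j: "j < length U" "U ! j" "V ! j" by blast
    have "first_pos W j < first_pos W (length U)" using first_pos_less[OF W j(1)] .
    then show "\<exists>j<first_pos W (length U). subst U W ! j \<and> subst V W ! j"
      using j l first_pos(1)[OF W] by (intro exI[of _ "first_pos W j"]) (simp add: nth_subst)
  qed
  then show ?thesis using True l first_pos(1)[OF W] by (simp add: adj_def nth_subst)
qed

lemma inj_subst:
  assumes W: "rigid W"
  shows "inj (\<lambda>U. subst U W)"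
proof (rule injI)
  fix U V :: "'a list" assume eq: "subst U W = subst V W"
  then have "first_pos W (length U) = first_pos W (length V)" by (metis length_subst)
  then have len: "length U = length V" using first_pos(1)[OF W] by metis
  show "U = V"
  proof (rule nth_equalityI[OF len])
    fix i assume i: "i < length U"
    have "subst U W ! first_pos W i = U ! i" "subst V W ! first_pos W i = V ! i"
      using i len first_pos_less[OF W i] first_pos(1)[OF W] by (simp_all add: nth_subst)
    then show "U ! i = V ! i" using eq by simp
  qed
qed

section \<open>Embeddings into the word graph\<close>

definition embedding :: "('a \<Rightarrow> 'b) \<Rightarrow> 'a sgraph \<Rightarrow> 'b sgraph \<Rightarrow> bool" where
  "embedding f G H \<longleftrightarrow> inj_on f (verts G) \<and> f ` verts G \<subseteq> verts H \<and>
     (\<forall>u \<in> verts G. \<forall>v \<in> verts G. (u, v) \<in> edges G \<longleftrightarrow> (f u, f v) \<in> edges H)"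

lemma embedding_comp:
  assumes "embedding f G H" "embedding g H K"
  shows "embedding (g \<circ> f) G K"
proof -
  have "inj_on (g \<circ> f) (verts G)"
    using assms unfolding embedding_def by (meson comp_inj_on inj_on_subset)
  then show ?thesis using assms by (simp add: embedding_def image_subset_iff)
qed

lemma embeds_embedding:
  assumes "embeds G H"
  shows "\<exists>f. embedding f G H"
proof -
  obtain A f where "induced_subgraph A H" "graph_iso f G A"
    using assms by (auto simp: embeds_def isomorphic_def)
  then have "embedding f G H"
    by (auto simp: embedding_def induced_subgraph_def graph_iso_def bij_betw_def)
  then show ?thesis by blast
qed

lemma embedding_subst: "rigid W \<Longrightarrow> embedding (\<lambda>U. subst U W) word_graph word_graph"
  by (simp add: embedding_def adj_subst inj_subst)

text \<open>A vertex goes to the row of its adjacencies to earlier vertices of an enumeration.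
  Adjacent vertices have no common neighbour, which is the second clause of \<open>adj\<close>;
  distinct vertices get words of distinct lengths.\<close>

lemma embedding_word_graph:
  assumes G: "is_graph G" "countable (verts G)" "triangle_free G"
  shows "\<exists>f. embedding f G word_graph"
proof -
  define p where "p = to_nat_on (verts G)"
  have inj: "inj_on p (verts G)" unfolding p_def by (rule inj_on_to_nat_on[OF G(2)])
  have sub: "edges G \<subseteq> verts G \<times> verts G" and sy: "sym (edges G)" and ir: "irrefl (edges G)"
    using G(1) by (auto simp: is_graph_def)
  define f where "f v = map (\<lambda>i. \<exists>u \<in> verts G. p u = i \<and> (u, v) \<in> edges G) [0..<p v]" for v
  have fl: "length (f v) = p v" for v by (simp add: f_def)
  have fn: "f v ! p u \<longleftrightarrow> (u, v) \<in> edges G" if "u \<in> verts G" "p u < p v" for u v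
    using that inj by (auto simp: f_def dest: inj_onD)
  have fn': "\<exists>u \<in> verts G. p u = i \<and> (u, v) \<in> edges G" if "f v ! i" "i < p v" for v i
    using that by (simp add: f_def)
  have tri: False if "(a, b) \<in> edges G" "(b, c) \<in> edges G" "(a, c) \<in> edges G" for a b c
    using that G(3) unfolding triangle_free_def by blast
  have adj: "adj (f u) (f v) \<longleftrightarrow> p u < p v \<and> (u, v) \<in> edges G"
    if uv: "u \<in> verts G" "v \<in> verts G" for u v
  proof (cases "p u < p v")
    case True
    have "\<not> (f u ! j \<and> f v ! j)" if j: "j < p u" and e: "(u, v) \<in> edges G" for j
    proof
      assume a: "f u ! j \<and> f v ! j"
      obtain x where x: "x \<in> verts G" "p x = j" "(x, u) \<in> edges G" using fn'[of u j] a j by blast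
      obtain y where y: "y \<in> verts G" "p y = j" "(y, v) \<in> edges G" using fn'[of v j] a j True by auto
      have "x = y" using inj x y by (auto dest: inj_onD)
      then show False using tri[of x u v] x y e by blast
    qed
    then show ?thesis using True fn[OF uv(1) True] by (auto simp: adj_def fl)
  qed (simp add: adj_def fl)
  have "(u, v) \<in> edges G \<longleftrightarrow> adj (f u) (f v) \<or> adj (f v) (f u)"
    if uv: "u \<in> verts G" "v \<in> verts G" for u v
  proof -
    have "u \<noteq> v" if "(u, v) \<in> edges G" using that ir by (auto simp: irrefl_def)
    then have "p u \<noteq> p v" if "(u, v) \<in> edges G" using that inj uv by (auto dest: inj_onD)
    moreover have "(u, v) \<in> edges G \<longleftrightarrow> (v, u) \<in> edges G" using sy by (auto dest: symD)
    ultimately show ?thesis unfolding adj[OF uv] adj[OF uv(2,1)] by (meson linorder_neqE_nat)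
  qed
  moreover have "inj_on f (verts G)" using inj fl unfolding inj_on_def by metis
  ultimately have "embedding f G word_graph" by (simp add: embedding_def)
  then show ?thesis by blast
qed

text \<open>Positions of the words in \<open>S\<close> are identified when every word has the same entry there; a
  word that ends makes the next column new, so truncation happens exactly at its end.\<close>

lemma envelope:
  fixes S :: "bool list set"
  assumes "finite S" "card S = g"
  defines "n \<equiv> 2 ^ g * 2 ^ g"
  shows "\<exists>E \<in> param_words 0 n. \<exists>S' \<subseteq> {V. length V \<le> n}. S = (\<lambda>V. list_subst V E) ` S'"
proof -
  \<comment> \<open>The column at \<open>j\<close>: the words that reach it and those with a 1
    there. \<open>cnt\<close> counts the distinct columns so far, and \<open>e\<close> numbers
    columns in order of first appearance.\<close>
  define col where "col j = ({w \<in> S. j < length w}, {w \<in> S. j < length w \<and> w ! j})" for j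
  define cnt where "cnt m = card (col ` {..<m})" for m
  define fo where "fo j = (LEAST i. col i = col j)" for j
  define e where "e j = cnt (fo j)" for j
  have cnt_less: "cnt i < cnt m" if "col i \<notin> col ` {..<i}" "i < m" for i m
    unfolding cnt_def using that by (intro psubset_card_mono) auto
  have cnt_mono: "cnt i \<le> cnt m" if "i \<le> m" for i m
    unfolding cnt_def using that by (intro card_mono) auto
  have fo: "col (fo j) = col j" "fo j \<le> j" for j
    unfolding fo_def by (rule LeastI[of _ j], simp) (rule Least_le, simp)
  have fo_new: "col (fo j) \<notin> col ` {..<fo j}" for j
  proof
    assume "col (fo j) \<in> col ` {..<fo j}"
    then obtain i where "i < fo j" "col i = col j" using fo(1)[of j] by auto
    then show False unfolding fo_def using not_less_Least by blast
  qed
  have e_less: "e j < cnt m" if "j < m" for j m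
    unfolding e_def using cnt_less[OF fo_new] fo(2)[of j] that by simp
  have e_new: "e j = cnt j" if "col j \<notin> col ` {..<j}" for j
  proof -
    have "fo j = j" using that fo[of j] by (metis image_eqI le_neq_implies_less lessThan_iff)
    then show ?thesis by (simp add: e_def)
  qed
  have e_eq: "col i = col j" if "e i = e j" for i j
  proof -
    have "\<not> fo i < fo j" "\<not> fo j < fo i"
      using that cnt_less[OF fo_new, of i "fo j"] cnt_less[OF fo_new, of j "fo i"] by (auto simp: e_def)
    then show ?thesis using fo(1) by (metis linorder_neqE_nat)
  qed
  obtain L where L: "\<And>w. w \<in> S \<Longrightarrow> length w \<le> L"
    using assms(1) finite_imageI[of S length] by (metis Max_ge image_eqI)
  have "cnt L \<le> card (Pow S \<times> Pow S)" unfolding cnt_def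
    by (rule card_mono) (use assms(1) in \<open>auto simp: col_def\<close>)
  then have cntL: "cnt L \<le> n" using assms(1,2) by (simp add: card_cartesian_product card_Pow n_def)
  \<comment> \<open>Fresh parameters bring the number to exactly \<open>n\<close>; the first of
    them, if any, stops the words of the maximal length \<open>L\<close>.\<close>
  define E where "E = map e [0..<L] @ [cnt L..<n]"
  have lenE: "length E = L + (n - cnt L)" by (simp add: E_def)
  have E1: "E ! i = e i" if "i < L" for i using that by (simp add: E_def nth_append)
  have E2: "E ! (L + d) = cnt L + d" if "d < n - cnt L" for d using that by (simp add: E_def nth_append)
  have "\<exists>j<length E. E ! j = m \<and> (\<forall>i<j. E ! i < m)" if m: "m < n" for m
  proof (cases "m < cnt L")
    case True
    define q where "q = (LEAST q. m < cnt q)"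
    have q: "m < cnt q" "q \<le> L" unfolding q_def using True by (rule LeastI, rule Least_le)
    have "q \<noteq> 0" using q(1) by (auto simp: cnt_def intro: ccontr)
    then obtain j where j: "q = Suc j" using not0_implies_Suc by blast
    have "\<not> m < cnt j" using not_less_Least[of j "\<lambda>q. m < cnt q"] j by (simp add: q_def)
    moreover have cS: "cnt (Suc j) = card (insert (col j) (col ` {..<j}))"
      by (simp add: cnt_def lessThan_Suc)
    moreover have new: "col j \<notin> col ` {..<j}"
    proof
      assume "col j \<in> col ` {..<j}"
      then have "cnt (Suc j) = cnt j" using cS by (simp add: cnt_def insert_absorb)
      then show False using q(1) j \<open>\<not> m < cnt j\<close> by simp
    qed
    ultimately have "cnt j = m" using q(1) j by (simp add: cnt_def)
    then show ?thesis using e_new[OF new] e_less[of _ j] E1 q(2) j lenE by (intro exI[of _ j]) auto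
  next
    case False
    define d where "d = m - cnt L"
    have d: "m = cnt L + d" "d < n - cnt L" using False m by (auto simp: d_def)
    have "E ! i < m" if "i < L + d" for i
    proof (cases "i < L")
      case True
      then show ?thesis using E1 e_less[OF True] d(1) by simp
    next
      case False
      then show ?thesis using E2[of "i - L"] that d by simp
    qed
    then show ?thesis using E2[OF d(2)] d lenE by (intro exI[of _ "L + d"]) auto
  qed
  moreover have "set E \<subseteq> {..<n}" using e_less cntL by (fastforce simp: E_def)
  ultimately have Ep: "E \<in> param_words 0 n" by (simp add: param_words_def restricted_growth_def)
  \<comment> \<open>Equal columns have equal entries, so any representative position before the end
    of \<open>w\<close> gives the right letter.\<close>
  define V where "V w = map (\<lambda>i. w ! (SOME j. j < length w \<and> e j = i)) [0..<cnt (length w)]"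
    for w :: "bool list"
  have Vl: "length (V w) = cnt (length w)" for w by (simp add: V_def)
  have VE: "list_subst (V w) E = w" if w: "w \<in> S" for w
  proof -
    have lw: "length w \<le> L" using L[OF w] .
    have "takeWhile (\<lambda>x. x < cnt (length w)) E = take (length w) E"
    proof (rule takeWhile_eq_take_P_nth)
      fix i assume "i < length w" "i < length E"
      then show "E ! i < cnt (length w)" using E1[of i] e_less lw by simp
    next
      assume l: "length w < length E"
      show "\<not> E ! length w < cnt (length w)"
      proof (cases "length w < L")
        case True
        have "w \<in> fst (col i)" if "i < length w" for i using that w by (simp add: col_def)
        moreover have "w \<notin> fst (col (length w))" by (simp add: col_def)
        ultimately have "col (length w) \<notin> col ` {..<length w}" by force
        then show ?thesis using E1[OF True] e_new by simp
      next
        case False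
        then have "length w = L" using lw by simp
        then show ?thesis using E2[of 0] l lenE by simp
      qed
    qed
    also have "\<dots> = map e [0..<length w]" using lw by (simp add: E_def take_map)
    finally have tw: "takeWhile (\<lambda>x. x < length (V w)) E = map e [0..<length w]" by (simp add: Vl)
    show ?thesis
    proof (rule nth_equalityI)
      fix i assume "i < length (list_subst (V w) E)"
      then have i: "i < length w" by (simp add: list_subst_def tw)
      define j where "j = (SOME j. j < length w \<and> e j = e i)"
      have j: "j < length w \<and> e j = e i" unfolding j_def by (rule someI[of _ i]) (simp add: i)
      then have "snd (col j) = snd (col i)" using e_eq by metis
      then have "w ! j = w ! i" using j i w by (auto simp: col_def)
      moreover have "list_subst (V w) E ! i = w ! j"
        using i e_less[OF i] by (simp add: list_subst_def tw) (simp add: V_def j_def)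
      ultimately show "list_subst (V w) E ! i = w ! i" by simp
    qed (simp add: list_subst_def tw)
  qed
  have "S = (\<lambda>V. list_subst V E) ` (V ` S)" using VE by force
  moreover have "V ` S \<subseteq> {V. length V \<le> n}"
  proof
    fix x assume "x \<in> V ` S"
    then obtain w where w: "w \<in> S" "x = V w" by blast
    have "cnt (length w) \<le> n" using cnt_mono[OF L[OF w(1)]] cntL by linarith
    then show "x \<in> {V. length V \<le> n}" using Vl w(2) by simp
  qed
  ultimately show ?thesis using Ep by blast
qed

text \<open>Colour an \<open>n\<close>-parameter word by the colours of all word sets inside it.  On the substituted
  copy this is constant, so the colour of a set only depends on how it sits in its envelope.\<close>

lemma word_sets_few_colours:
  fixes \<chi> :: "bool list set \<Rightarrow> nat" and g :: nat
  defines "n \<equiv> 2 ^ g * 2 ^ g"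
  assumes bd: "\<And>S. \<chi> S \<le> k"
  shows "\<exists>W \<in> rigids 0. card (\<chi> ` {(\<lambda>U. subst U W) ` S |S. finite S \<and> card S = g})
           \<le> card (Pow {V :: bool list. length V \<le> n})"
proof -
  let ?D = "Pow {V :: bool list. length V \<le> n}"
  have fin: "finite ?D" using finite_lists_length_le[of "UNIV :: bool set" n] by simp
  define \<psi> where "\<psi> E = (\<lambda>S'\<in>?D. \<chi> ((\<lambda>V. list_subst V E) ` S'))" for E
  have "\<psi> ` param_words 0 n \<subseteq> PiE ?D (\<lambda>_. {..k})" using bd by (simp add: image_subset_iff \<psi>_def del: Pow_iff)
  then have "finite (\<psi> ` param_words 0 n)"
    using finite_PiE[OF fin, of "\<lambda>_. {..k}"] finite_subset by blast
  then obtain W c where W: "W \<in> rigids 0" and c: "\<And>E. E \<in> param_words 0 n \<Longrightarrow> \<psi> (subst E W) = c"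
    using ramsey_finite[OF ramsey_param_words] by metis
  have "\<chi> ((\<lambda>U. subst U W) ` S) \<in> c ` ?D" if S: "finite S" "card S = g" for S
  proof -
    obtain E S' where E: "E \<in> param_words 0 n" and S': "S' \<in> ?D" "S = (\<lambda>V. list_subst V E) ` S'"
      using envelope[OF S] unfolding n_def by blast
    have "c S' = \<psi> (subst E W) S'" using c[OF E] by simp
    also have "\<dots> = \<chi> ((\<lambda>V. list_subst V (subst E W)) ` S')" using S'(1) by (simp add: \<psi>_def)
    also have "(\<lambda>V. list_subst V (subst E W)) ` S' = (\<lambda>U. subst U W) ` S"
      by (simp add: S'(2) image_image list_subst_subst[OF rigids_rigid[OF W]])
    finally show ?thesis using S'(1) by (metis image_eqI)
  qed
  then have "\<chi> ` {(\<lambda>U. subst U W) ` S |S. finite S \<and> card S = g} \<subseteq> c ` ?D" by blast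
  then have "card (\<chi> ` {(\<lambda>U. subst U W) ` S |S. finite S \<and> card S = g}) \<le> card ?D"
    using fin by (meson card_image_le card_mono finite_imageI le_trans)
  then show ?thesis using W by blast
qed

section \<open>Transfer from the word graph to the given graph\<close>

theorem mainTheorem1:
  fixes H :: "'a sgraph" and G :: "'b sgraph"
  assumes "henson_graph H"
    and "is_graph G" and "finite (verts G)" and "triangle_free G"
  shows "\<exists>T::nat. \<forall>k::nat. k \<ge> 1 \<longrightarrow>
           (\<forall>\<chi> :: 'a sgraph \<Rightarrow> nat. \<chi> ` copies G H \<subseteq> {..<k} \<longrightarrow>
              (\<exists>H'. induced_subgraph H' H \<and> isomorphic H H' \<and>
                    card (\<chi> ` copies G H') \<le> T))"
proof -
  have H: "is_graph H" "countable (verts H)" "triangle_free H" "universal_triangle_free H"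
    using assms(1) by (auto simp: henson_graph_def)
  define g where "g = card (verts G)"
  \<comment> \<open>The number of possible positions of a word set inside its envelope;
    \<open>k\<close> does not enter.\<close>
  define T where "T = card (Pow {V :: bool list. length V \<le> 2 ^ g * 2 ^ g})"
  obtain h where h: "embedding h word_graph H"
    using embeds_embedding[OF universal_triangle_free_embeds[OF H(4) is_graph_word_graph _
          triangle_free_word_graph]] by auto
  obtain f where f: "embedding f H word_graph" using embedding_word_graph[OF H(1-3)] by blast
  define ind where "ind S = \<lparr>verts = S, edges = edges H \<inter> (S \<times> S)\<rparr>" for S
  show ?thesis
  proof (intro exI[of _ T] allI impI)
    fix k :: nat and \<chi> :: "'a sgraph \<Rightarrow> nat"
    assume \<chi>: "\<chi> ` copies G H \<subseteq> {..<k}"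
    \<comment> \<open>\<open>\<chi>\<close> is bounded only on copies of \<open>G\<close>, but every
      word set needs a colour from a finite range. On copies the minimum is \<open>\<chi>\<close>
      itself.\<close>
    define \<chi>' where "\<chi>' S = min (\<chi> (ind (h ` S))) k" for S
    obtain W where W: "W \<in> rigids 0"
      and few: "card (\<chi>' ` {(\<lambda>U. subst U W) ` S |S. finite S \<and> card S = g}) \<le> T"
      using word_sets_few_colours[of \<chi>' k g] unfolding T_def \<chi>'_def by auto
    \<comment> \<open>Into the word graph, then into the subspace with few colours, and back into
      \<open>H\<close>.\<close>
    define \<phi> where "\<phi> = h \<circ> ((\<lambda>U. subst U W) \<circ> f)"
    have \<phi>: "embedding \<phi> H H" unfolding \<phi>_def
      by (rule embedding_comp[OF embedding_comp[OF f embedding_subst[OF rigids_rigid[OF W]]] h])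
    define H' where "H' = ind (\<phi> ` verts H)"
    have "induced_subgraph H' H" using \<phi> by (simp add: H'_def ind_def induced_subgraph_def embedding_def)
    moreover have "graph_iso \<phi> H H'"
      using \<phi> by (auto simp: H'_def ind_def graph_iso_def embedding_def bij_betw_def)
    then have "isomorphic H H'" by (auto simp: isomorphic_def)
    moreover have "card (\<chi> ` copies G H') \<le> T"
    proof -
      let ?R = "\<chi>' ` {(\<lambda>U. subst U W) ` S |S. finite S \<and> card S = g}"
      have "\<chi> A \<in> ?R" if A: "A \<in> copies G H'" for A
      proof -
        obtain i where i: "graph_iso i G A" and AH': "induced_subgraph A H'"
          using A by (auto simp: copies_def isomorphic_def)
        have AH: "induced_subgraph A H"
          using AH' \<open>induced_subgraph H' H\<close> by (auto simp: induced_subgraph_def)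
        then have "A \<in> copies G H" using i by (auto simp: copies_def isomorphic_def)
        then have k: "\<chi> A < k" using \<chi> by blast
        have Aind: "A = ind (verts A)" using AH by (simp add: induced_subgraph_def ind_def)
        have fA: "finite (verts A)" "card (verts A) = g"
          using i assms(3) by (auto simp: graph_iso_def g_def bij_betw_same_card dest: bij_betw_finite)
        have "verts A \<subseteq> \<phi> ` verts H" using AH' by (simp add: induced_subgraph_def H'_def ind_def)
        then obtain B where B: "B \<subseteq> verts H" "verts A = \<phi> ` B" by (meson subset_imageE)
        have "inj_on \<phi> B" using \<phi> B(1) by (auto simp: embedding_def intro: inj_on_subset)
        then have fB: "finite B" "card B = g" using fA B(2) by (auto simp: card_image dest: finite_imageD)
        have "inj_on f B" using f B(1) by (auto simp: embedding_def intro: inj_on_subset)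
        then have fS: "finite (f ` B)" "card (f ` B) = g" using fB by (auto simp: card_image)
        have "\<chi>' ((\<lambda>U. subst U W) ` (f ` B)) = min (\<chi> (ind (verts A))) k"
          by (simp add: \<chi>'_def B(2) \<phi>_def image_image)
        also have "\<dots> = \<chi> A" using k Aind by simp
        finally have eq: "\<chi>' ((\<lambda>U. subst U W) ` (f ` B)) = \<chi> A" .
        have "(\<lambda>U. subst U W) ` (f ` B) \<in> {(\<lambda>U. subst U W) ` S |S. finite S \<and> card S = g}"
          using fS by blast
        from imageI[OF this, of \<chi>'] show ?thesis unfolding eq .
      qed
      moreover have "finite ?R"
        by (rule finite_subset[of _ "{..k}"]) (auto simp: \<chi>'_def)
      ultimately show ?thesis using few by (meson card_mono image_subsetI le_trans)
    qed
    ultimately show "\<exists>H'. induced_subgraph H' H \<and> isomorphic H H' \<and> card (\<chi> ` copies G H') \<le> T"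
      by blast
  qed
qed

end
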